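(* Let $F=F(X)$ be the free group with basis $X=\{x_1,\dots,x_r\}$, let $N$ be a normal subgroup of $F$, $H=F/N'$ with $N'=[N,N]$, and $w\in F$. Then: (1) If $Q$ is a minimal forest for $w$, then $w_{p_Q}$ is a geodesic word for $w$ in $H$ (relative to $X$), and $$l_X(w)=\sum_{e\in \mathrm{supp}(\pi_w)}|\pi_w(e)|+2|E(Q)|.$$ (2) Every geodesic word for $w$ in $H$ (relative to $X$) is equal in $F$ to a word $w_{p_Q}$ for a suitable minimal forest $Q$ for $w$ and a suitable Euler path $p_Q^\ast$.
   Context: $G=F/N$, $\mu:F\to G$ is the canonical epimorphism, and $\Gamma=\Gamma(G,X)$ is the Cayley graph: vertex set $G$ and, for each $g\in G$, $x\in X$, one positive edge labeled $x$ from $g$ to $gx^\mu$. $\hat\Gamma$ is $\Gamma$ with a formal inverse $e^{-1}$ (reversed direction, inverse label) added for each edge $e$; paths in $\Gamma$ are paths in $\hat\Gamma$. For a path $p$, $\pi_p:E(\Gamma)\to\mathbb{Z}$ gives the algebraic number of traversals of each positive edge ($+1$ per positive traversal, $-1$ per negative one). For $w\in F$, $p_w$ is the path from $1$ to $w^\mu$ in $\Gamma$ with label $w$, $\pi_w=\pi_{p_w}$, and $\mathrm{supp}(\pi_w)=\{e\in E(\Gamma):\pi_w(e)\ne0\}$. Geodesic length in $H$: $l_X(w)=\min\{|u| : u\in F,\ u=w \text{ in } H\}$. A geodesic word for $w$ is a word $u\in F$ with $u=w$ in $H$ and $|u|=l_X(w)$. Elements of $F$ are viewed as freely reduced words. Minimal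 forest: let $\Gamma_w$ be the subgraph of $\Gamma$ generated by $\mathrm{supp}(\pi_w)\cup\{1,w^\mu\}$ (these edges, their endpoints, and the vertices $1$, $w^\mu$). A minimal forest for $w$ is a finite subgraph $Q$ of $\Gamma$ such that $\Delta=\Gamma_w\cup Q$ is connected (as an undirected graph) and $Q$ has the least number of edges among all such subgraphs. The words $w_{p_Q}$: given a minimal forest $Q$, let $\Delta^\ast$ be the finite directed multigraph on the vertices of $\Delta$ in which each edge $e\in\mathrm{supp}(\pi_w)$ is replaced by $|\pi_w(e)|$ parallel edges, directed from $o(e)$ to $t(e)$ with the label of $e$ if $\pi_w(e)>0$, and directed from $t(e)$ to $o(e)$ with the inverse label if $\pi_w(e)<0$; and each edge $e$ of $Q$ (for which $\pi_w(e)=0$) is replaced by two edges, one copy of $e$ and one copy of $e^{-1}$. Let $\phi:\Delta^\ast\to\hat\Delta$ be the natural morphism sending each replica to $e$ or $e^{-1}$. An Euler path $p_Q^\ast$ is a directed path in $\Delta^\ast$ from $1$ to $w^\mu$ traversing every edge of $\Delta^\ast$ exactly once (a closed Euler tour at $1$ if $w\in N$). Put $p_Q=\phi(p_Q^\ast)$, and let $w_{p_Q}$ be the label of $p_Q$. *)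

theory Defs
  imports "HOL-Algebra.Generated_Groups" "Graph_Theory.Euler"
begin

section \<open>Free groups\<close>

text \<open>A letter \<open>(x, True)\<close> stands for the generator \<open>x\<close>, and \<open>(x, False)\<close> for its inverse.\<close>

type_synonym 'a letter = "'a \<times> bool"
type_synonym 'a word = "'a letter list"

definition inv_letter :: "'a letter \<Rightarrow> 'a letter" where
  "inv_letter a = (fst a, \<not> snd a)"

definition freely_reduced :: "'a word \<Rightarrow> bool" where
  "freely_reduced = successively (\<lambda>a b. b \<noteq> inv_letter a)"

fun reduced_cons :: "'a letter \<Rightarrow> 'a word \<Rightarrow> 'a word" where
  "reduced_cons a [] = [a]"
| "reduced_cons a (b # v) = (if b = inv_letter a then v else a # b # v)"

definition free_reduce :: "'a word \<Rightarrow> 'a word" where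
  "free_reduce w = foldr reduced_cons w []"

definition free_group :: "'a set \<Rightarrow> 'a word monoid" where
  "free_group X =
    \<lparr>carrier = {w. set w \<subseteq> X \<times> UNIV \<and> freely_reduced w},
     monoid.mult = \<lambda>u v. free_reduce (u @ v),
     monoid.one = []\<rparr>"

lemma inv_letter_inv_letter [simp]: "inv_letter (inv_letter a) = a"
  by (simp add: inv_letter_def)

lemma inv_letter_eq_iff [simp]: "inv_letter a = inv_letter b \<longleftrightarrow> a = b"
  by (metis inv_letter_inv_letter)

lemma inv_letter_neq [simp]: "inv_letter a \<noteq> a" "a \<noteq> inv_letter a"
  by (auto simp: inv_letter_def prod_eq_iff)

lemma freely_reduced_Nil [simp]: "freely_reduced []"
  by (simp add: freely_reduced_def)

lemma freely_reduced_Cons: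
  "freely_reduced (a # v) \<longleftrightarrow> freely_reduced v \<and> (v = [] \<or> hd v \<noteq> inv_letter a)"
  by (cases v) (auto simp: freely_reduced_def)

lemma freely_reduced_reduced_cons:
  "freely_reduced v \<Longrightarrow> freely_reduced (reduced_cons a v)"
  by (cases v) (auto simp: freely_reduced_Cons)

lemma freely_reduced_foldr:
  "freely_reduced v \<Longrightarrow> freely_reduced (foldr reduced_cons u v)"
  by (induction u) (auto simp: freely_reduced_reduced_cons)

lemma freely_reduced_free_reduce: "freely_reduced (free_reduce w)"
  by (simp add: free_reduce_def freely_reduced_foldr)

lemma reduced_cons_eq_Cons: "freely_reduced (a # v) \<Longrightarrow> reduced_cons a v = a # v"
  by (cases v) (auto simp: freely_reduced_Cons)

lemma free_reduce_id: "freely_reduced w \<Longrightarrow> free_reduce w = w"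
proof (induction w)
  case (Cons a w)
  then show ?case
    using reduced_cons_eq_Cons[OF Cons.prems] by (simp add: free_reduce_def freely_reduced_Cons)
qed (simp add: free_reduce_def)

lemma set_reduced_cons: "set (reduced_cons a v) \<subseteq> insert a (set v)"
  by (cases v) auto

lemma set_free_reduce: "set (free_reduce w) \<subseteq> set w"
proof (induction w)
  case (Cons a w)
  then show ?case
    using set_reduced_cons[of a "free_reduce w"] by (auto simp: free_reduce_def)
qed (simp add: free_reduce_def)

lemma reduced_cons_inv:
  assumes "freely_reduced v"
  shows "reduced_cons (inv_letter a) (reduced_cons a v) = v"
proof (cases v)
  case (Cons b u)
  show ?thesis
  proof (cases "b = inv_letter a")
    case True
    with assms Cons show ?thesis by (cases u) (auto simp: freely_reduced_Cons)
  qed (use Cons in auto)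
qed auto

lemma foldr_reduced_cons_reduced_cons:
  assumes "freely_reduced v"
  shows "foldr reduced_cons (reduced_cons a u) v = reduced_cons a (foldr reduced_cons u v)"
proof (cases u)
  case (Cons b t)
  then show ?thesis
    using reduced_cons_inv[OF freely_reduced_foldr[OF assms, of t], of b] by auto
qed auto

lemma foldr_free_reduce:
  "freely_reduced v \<Longrightarrow> foldr reduced_cons (free_reduce u) v = foldr reduced_cons u v"
  by (induction u) (auto simp: free_reduce_def foldr_reduced_cons_reduced_cons)

lemma free_reduce_append1: "free_reduce (free_reduce u @ v) = free_reduce (u @ v)"
  using foldr_free_reduce[OF freely_reduced_free_reduce[of v], of u]
  by (simp add: free_reduce_def)

lemma free_reduce_append2: "free_reduce (u @ free_reduce v) = free_reduce (u @ v)"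
  using free_reduce_id[OF freely_reduced_free_reduce[of v]] by (simp add: free_reduce_def)

definition inv_word :: "'a word \<Rightarrow> 'a word" where
  "inv_word w = rev (map inv_letter w)"

lemma free_reduce_inv_word: "free_reduce (inv_word w @ w) = []"
proof (induction w)
  case (Cons a w)
  have "foldr reduced_cons (inv_word (a # w) @ a # w) [] =
      foldr reduced_cons (inv_word w) (reduced_cons (inv_letter a) (reduced_cons a (free_reduce w)))"
    by (simp add: inv_word_def free_reduce_def)
  also have "\<dots> = free_reduce (inv_word w @ w)"
    by (simp add: reduced_cons_inv freely_reduced_free_reduce) (simp add: free_reduce_def)
  finally show ?case using Cons by (simp add: free_reduce_def)
qed (simp add: free_reduce_def inv_word_def)

lemma group_free_group: "group (free_group X)"
proof (rule groupI)
  fix w assume w: "w \<in> carrier (free_group X)"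
  have "set (inv_word w) \<subseteq> X \<times> UNIV"
    using w by (auto simp: inv_word_def free_group_def inv_letter_def)
  then have "free_reduce (inv_word w) \<in> carrier (free_group X)"
    using set_free_reduce[of "inv_word w"] freely_reduced_free_reduce by (auto simp: free_group_def)
  moreover have "free_reduce (inv_word w) \<otimes>\<^bsub>free_group X\<^esub> w = \<one>\<^bsub>free_group X\<^esub>"
    by (simp add: free_group_def free_reduce_append1 free_reduce_inv_word)
  ultimately show "\<exists>y\<in>carrier (free_group X). y \<otimes>\<^bsub>free_group X\<^esub> w = \<one>\<^bsub>free_group X\<^esub>" ..
next
  fix u v assume "u \<in> carrier (free_group X)" "v \<in> carrier (free_group X)"
  then show "u \<otimes>\<^bsub>free_group X\<^esub> v \<in> carrier (free_group X)"
    using set_free_reduce[of "u @ v"] freely_reduced_free_reduce by (auto simp: free_group_def)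
qed (auto simp: free_group_def free_reduce_append1 free_reduce_append2 free_reduce_id)


section \<open>Geodesics in quotients of free groups\<close>

text \<open>
  For \<open>M\<close> normal in \<open>F = free_group X\<close>, elements \<open>u, w\<close> of \<open>F\<close> are equal in \<open>F/M\<close> iff their
  images \<open>M #> u\<close> and \<open>M #> w\<close> in \<^term>\<open>free_group X Mod M\<close> coincide.
\<close>

definition geodesic_length :: "'a set \<Rightarrow> 'a word set \<Rightarrow> 'a word \<Rightarrow> nat" where
  "geodesic_length X M w =
    (LEAST n. \<exists>u \<in> carrier (free_group X).
       M #>\<^bsub>free_group X\<^esub> u = M #>\<^bsub>free_group X\<^esub> w \<and> length u = n)"

definition geodesic_word :: "'a set \<Rightarrow> 'a word set \<Rightarrow> 'a word \<Rightarrow> 'a word \<Rightarrow> bool" where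
  "geodesic_word X M w u \<longleftrightarrow>
    u \<in> carrier (free_group X) \<and>
    M #>\<^bsub>free_group X\<^esub> u = M #>\<^bsub>free_group X\<^esub> w \<and>
    length u = geodesic_length X M w"


section \<open>The Cayley graph, paths and flows\<close>

text \<open>
  The edge \<open>(g, x)\<close> is the positive edge labelled \<open>x\<close> from \<open>g\<close> to \<open>g x\<^sup>\<mu>\<close>.  Vertices are the
  elements of \<open>G = F/N\<close>, i.e. cosets, and \<open>w\<^sup>\<mu>\<close> is the coset \<open>N #> w\<close>.
\<close>

type_synonym 'a vertex = "'a word set"
type_synonym 'a edge = "'a vertex \<times> 'a"

definition cayley_graph :: "'a set \<Rightarrow> 'a word set \<Rightarrow> ('a vertex, 'a edge) pre_digraph" where
  "cayley_graph X N =
    \<lparr>verts = carrier (free_group X Mod N),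
     arcs = carrier (free_group X Mod N) \<times> X,
     tail = fst,
     head = \<lambda>(g, x). g \<otimes>\<^bsub>free_group X Mod N\<^esub> (N #>\<^bsub>free_group X\<^esub> [(x, True)])\<rparr>"

text \<open>In the graph with formal inverses, \<open>(e, True)\<close> is the edge \<open>e\<close> and \<open>(e, False)\<close> is \<open>e\<inverse>\<close>.\<close>

definition with_inverses :: "('v, 'e) pre_digraph \<Rightarrow> ('v, 'e \<times> bool) pre_digraph" where
  "with_inverses \<Gamma> =
    \<lparr>verts = verts \<Gamma>,
     arcs = arcs \<Gamma> \<times> UNIV,
     tail = \<lambda>(e, b). if b then tail \<Gamma> e else head \<Gamma> e,
     head = \<lambda>(e, b). if b then head \<Gamma> e else tail \<Gamma> e\<rparr>"

definition edge_label :: "'a edge \<times> bool \<Rightarrow> 'a letter" where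
  "edge_label a = (snd (fst a), snd a)"

definition path_label :: "('a edge \<times> bool) list \<Rightarrow> 'a word" where
  "path_label = map edge_label"

definition flow :: "('e \<times> bool) list \<Rightarrow> 'e \<Rightarrow> int" where
  "flow p e = int (count_list p (e, True)) - int (count_list p (e, False))"

fun path_from :: "'a set \<Rightarrow> 'a word set \<Rightarrow> 'a vertex \<Rightarrow> 'a word \<Rightarrow> ('a edge \<times> bool) list" where
  "path_from X N g [] = []"
| "path_from X N g ((x, True) # w) =
    ((g, x), True) #
      path_from X N (g \<otimes>\<^bsub>free_group X Mod N\<^esub> (N #>\<^bsub>free_group X\<^esub> [(x, True)])) w"
| "path_from X N g ((x, False) # w) =
    (let h = g \<otimes>\<^bsub>free_group X Mod N\<^esub> inv\<^bsub>free_group X Mod N\<^esub> (N #>\<^bsub>free_group X\<^esub> [(x, True)])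
     in ((h, x), False) # path_from X N h w)"

definition word_path :: "'a set \<Rightarrow> 'a word set \<Rightarrow> 'a word \<Rightarrow> ('a edge \<times> bool) list" where
  "word_path X N w = path_from X N \<one>\<^bsub>free_group X Mod N\<^esub> w"

lemma path_label_word_path: "path_label (word_path X N w) = w"
proof -
  have "path_label (path_from X N g w) = w" for g
    by (induction X N g w rule: path_from.induct)
      (auto simp: path_label_def edge_label_def Let_def)
  then show ?thesis by (simp add: word_path_def)
qed

lemma awalk_path_from:
  assumes N: "N \<lhd> free_group X" and "w \<in> carrier (free_group X)"
    and "g \<in> carrier (free_group X Mod N)"
  shows "pre_digraph.awalk (with_inverses (cayley_graph X N)) g (path_from X N g w)
    (g \<otimes>\<^bsub>free_group X Mod N\<^esub> (N #>\<^bsub>free_group X\<^esub> w))"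
  using assms(2,3)
proof (induction w arbitrary: g)
  case Nil
  interpret N: normal N "free_group X" by (fact N)
  interpret Q: group "free_group X Mod N" by (rule N.factorgroup_is_group)
  have "N #>\<^bsub>free_group X\<^esub> [] = \<one>\<^bsub>free_group X Mod N\<^esub>"
    using N.coset_mult_one[OF N.subset] by (simp add: FactGroup_def free_group_def)
  then have "g \<otimes>\<^bsub>free_group X Mod N\<^esub> (N #>\<^bsub>free_group X\<^esub> []) = g"
    using Q.r_one[OF Nil.prems(2)] by metis
  with Nil show ?case
    by (simp del: mult_FactGroup add: pre_digraph.awalk_def pre_digraph.cas.simps with_inverses_def cayley_graph_def)
next
  case (Cons a w)
  note mult_FactGroup [simp del] one_FactGroup [simp del]
  interpret N: normal N "free_group X" by (fact N)
  interpret Q: group "free_group X Mod N" by (rule N.factorgroup_is_group)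
  define \<mu> where "\<mu> = (\<lambda>u. N #>\<^bsub>free_group X\<^esub> u)"
  have hom: "\<mu> u \<otimes>\<^bsub>free_group X Mod N\<^esub> \<mu> v = \<mu> (u \<otimes>\<^bsub>free_group X\<^esub> v)"
    if "u \<in> carrier (free_group X)" "v \<in> carrier (free_group X)" for u v
    using N.rcos_sum[OF that] by (simp add: \<mu>_def FactGroup_def)
  have clos: "\<mu> u \<in> carrier (free_group X Mod N)" if "u \<in> carrier (free_group X)" for u
    using that by (auto simp: \<mu>_def FactGroup_def RCOSETS_def)
  obtain x b where a: "a = (x, b)" by force
  have car: "w \<in> carrier (free_group X)" "\<And>b. [(x, b)] \<in> carrier (free_group X)" "x \<in> X"
    using Cons.prems(1) by (auto simp: free_group_def a freely_reduced_Cons)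
  have "[a] \<otimes>\<^bsub>free_group X\<^esub> w = a # w"
    using Cons.prems(1) free_reduce_id[of "a # w"] by (simp add: free_group_def)
  then have split: "\<mu> (a # w) = \<mu> [a] \<otimes>\<^bsub>free_group X Mod N\<^esub> \<mu> w"
    using hom[of "[a]" w] car by (simp add: a)
  have "\<mu> [(x, False)] \<otimes>\<^bsub>free_group X Mod N\<^esub> \<mu> [(x, True)] = \<mu> \<one>\<^bsub>free_group X\<^esub>"
    using hom[of "[(x, False)]" "[(x, True)]"] car
    by (simp add: free_group_def free_reduce_def inv_letter_def)
  also have "\<dots> = \<one>\<^bsub>free_group X Mod N\<^esub>"
    using N.coset_mult_one[OF N.subset] by (simp add: \<mu>_def FactGroup_def)
  finally have invx: "inv\<^bsub>free_group X Mod N\<^esub> (\<mu> [(x, True)]) = \<mu> [(x, False)]"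
    using Q.inv_equality clos car by blast
  define h where "h = g \<otimes>\<^bsub>free_group X Mod N\<^esub> \<mu> [a]"
  have h: "h \<in> carrier (free_group X Mod N)"
    using Cons.prems(2) clos car by (simp add: h_def a)
  have IH: "pre_digraph.awalk (with_inverses (cayley_graph X N)) h (path_from X N h w)
      (h \<otimes>\<^bsub>free_group X Mod N\<^esub> \<mu> w)"
    using Cons.IH[OF car(1) h] by (simp add: \<mu>_def)
  have target: "h \<otimes>\<^bsub>free_group X Mod N\<^esub> \<mu> w = g \<otimes>\<^bsub>free_group X Mod N\<^esub> \<mu> (a # w)"
    using Cons.prems(2) clos car by (simp add: h_def split[unfolded a] Q.m_assoc a)
  show ?case
  proof (cases b)
    case True
    then show ?thesis
      using IH[unfolded target] Cons.prems(2) car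
      by (auto simp: a h_def \<mu>_def pre_digraph.awalk_def pre_digraph.cas.simps
          with_inverses_def cayley_graph_def)
  next
    case False
    have gx: "h \<otimes>\<^bsub>free_group X Mod N\<^esub> \<mu> [(x, True)] = g"
    proof -
      have "h = g \<otimes>\<^bsub>free_group X Mod N\<^esub> inv\<^bsub>free_group X Mod N\<^esub> (\<mu> [(x, True)])"
        using False by (simp add: h_def a invx)
      then show ?thesis
        using Cons.prems(2) clos car by (simp add: Q.m_assoc)
    qed
    have "path_from X N g (a # w) = ((h, x), False) # path_from X N h w"
      using False invx by (simp add: a h_def \<mu>_def Let_def)
    then show ?thesis
      using IH[unfolded target] Cons.prems(2) car h gx
      by (auto simp: \<mu>_def pre_digraph.awalk_def pre_digraph.cas.simps
          with_inverses_def cayley_graph_def)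
  qed
qed

lemma awalk_word_path:
  assumes "N \<lhd> free_group X" "w \<in> carrier (free_group X)"
  shows "pre_digraph.awalk (with_inverses (cayley_graph X N))
    \<one>\<^bsub>free_group X Mod N\<^esub> (word_path X N w) (N #>\<^bsub>free_group X\<^esub> w)"
proof -
  interpret N: normal N "free_group X" by fact
  interpret Q: group "free_group X Mod N" by (rule N.factorgroup_is_group)
  have "N #>\<^bsub>free_group X\<^esub> w \<in> carrier (free_group X Mod N)"
    using assms by (auto simp: FactGroup_def RCOSETS_def)
  then show ?thesis
    using awalk_path_from[OF assms Q.one_closed] Q.l_one unfolding word_path_def by metis
qed

definition word_flow :: "'a set \<Rightarrow> 'a word set \<Rightarrow> 'a word \<Rightarrow> 'a edge \<Rightarrow> int" where
  "word_flow X N w = flow (word_path X N w)"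

definition flow_support :: "'a set \<Rightarrow> 'a word set \<Rightarrow> 'a word \<Rightarrow> 'a edge set" where
  "flow_support X N w = {e \<in> arcs (cayley_graph X N). word_flow X N w e \<noteq> 0}"


section \<open>Minimal forests and Euler paths\<close>

definition support_graph ::
  "'a set \<Rightarrow> 'a word set \<Rightarrow> 'a word \<Rightarrow> ('a vertex, 'a edge) pre_digraph" where
  "support_graph X N w =
    \<lparr>verts = tail (cayley_graph X N) ` flow_support X N w \<union>
             head (cayley_graph X N) ` flow_support X N w \<union>
             {\<one>\<^bsub>free_group X Mod N\<^esub>, N #>\<^bsub>free_group X\<^esub> w},
     arcs = flow_support X N w,
     tail = tail (cayley_graph X N),
     head = head (cayley_graph X N)\<rparr>"

text \<open>\<^const>\<open>Digraph_Component.connected\<close> is connectedness of the underlying undirected graph.\<close>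

definition connecting_subgraph ::
  "'a set \<Rightarrow> 'a word set \<Rightarrow> 'a word \<Rightarrow> ('a vertex, 'a edge) pre_digraph \<Rightarrow> bool" where
  "connecting_subgraph X N w Q \<longleftrightarrow>
    fin_digraph Q \<and> subgraph Q (cayley_graph X N) \<and>
    Digraph_Component.connected (Digraph_Component.union (support_graph X N w) Q)"

definition minimal_forest ::
  "'a set \<Rightarrow> 'a word set \<Rightarrow> 'a word \<Rightarrow> ('a vertex, 'a edge) pre_digraph \<Rightarrow> bool" where
  "minimal_forest X N w Q \<longleftrightarrow>
    connecting_subgraph X N w Q \<and>
    (\<forall>Q'. connecting_subgraph X N w Q' \<longrightarrow> card (arcs Q) \<le> card (arcs Q'))"

text \<open>
  A replica of the (positive or inverse) edge \<open>(e, b)\<close> is a pair \<open>((e, b), i)\<close> with a running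
  index \<open>i\<close>; hence the natural morphism \<open>\<phi>\<close> to the graph with formal inverses is \<open>fst\<close>.
\<close>

definition replica_graph ::
  "'a set \<Rightarrow> 'a word set \<Rightarrow> 'a word \<Rightarrow> ('a vertex, 'a edge) pre_digraph
    \<Rightarrow> ('a vertex, ('a edge \<times> bool) \<times> nat) pre_digraph" where
  "replica_graph X N w Q =
    \<lparr>verts = verts (Digraph_Component.union (support_graph X N w) Q),
     arcs = {((e, b), i). e \<in> flow_support X N w \<and> b = (word_flow X N w e > 0) \<and>
                          i < nat \<bar>word_flow X N w e\<bar>} \<union>
            {((e, b), i). e \<in> arcs Q \<and> word_flow X N w e = 0 \<and> i = 0},
     tail = tail (with_inverses (cayley_graph X N)) \<circ> fst,
     head = head (with_inverses (cayley_graph X N)) \<circ> fst\<rparr>"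

definition euler_path ::
  "'a set \<Rightarrow> 'a word set \<Rightarrow> 'a word \<Rightarrow> ('a vertex, 'a edge) pre_digraph
    \<Rightarrow> (('a edge \<times> bool) \<times> nat) list \<Rightarrow> bool" where
  "euler_path X N w Q p \<longleftrightarrow>
    pre_digraph.euler_trail (replica_graph X N w Q) \<one>\<^bsub>free_group X Mod N\<^esub> p (N #>\<^bsub>free_group X\<^esub> w)"

text \<open>
  The clause of \<^const>\<open>pre_digraph.euler_trail\<close> that all vertices are visited is automatic here,
  since the graph of replicas is connected.
\<close>

lemma mk_symmetric_replica_graph:
  assumes "subgraph Q (cayley_graph X N)"
  shows "mk_symmetric (replica_graph X N w Q) =
    mk_symmetric (Digraph_Component.union (support_graph X N w) Q)"
proof -
  let ?R = "replica_graph X N w Q" and ?U = "Digraph_Component.union (support_graph X N w) Q"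
  let ?C = "cayley_graph X N"
  have sub: "arcs Q \<subseteq> arcs ?C" using assms by (auto simp: subgraph_def)
  have ends: "tail ?R ((e, b), i) = (if b then tail ?C e else head ?C e)"
    "head ?R ((e, b), i) = (if b then head ?C e else tail ?C e)" for e b i
    by (auto simp: replica_graph_def with_inverses_def)
  have U: "tail ?U = tail ?C" "head ?U = head ?C" "arcs ?U = flow_support X N w \<union> arcs Q"
    "verts ?R = verts ?U"
    by (auto simp: Digraph_Component.union_def support_graph_def replica_graph_def)
  have parcs_U: "parcs (mk_symmetric ?U) =
      (\<Union>e\<in>arcs ?U. {(tail ?C e, head ?C e), (head ?C e, tail ?C e)})"
    unfolding mk_symmetric_def U by simp
  have fwd: "e \<in> arcs ?U" if "((e, b), i) \<in> arcs ?R" for e b i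
    using that by (auto simp: replica_graph_def Digraph_Component.union_def support_graph_def)
  have bwd: "\<exists>b. ((e, b), 0) \<in> arcs ?R" if "e \<in> arcs ?U" for e
    using that sub unfolding U by (cases "word_flow X N w e = 0") (auto simp: replica_graph_def U flow_support_def)
  have "parcs (mk_symmetric ?R) = parcs (mk_symmetric ?U)"
  proof
    show "parcs (mk_symmetric ?R) \<subseteq> parcs (mk_symmetric ?U)"
    proof
      fix z assume "z \<in> parcs (mk_symmetric ?R)"
      then obtain e b i where "((e, b), i) \<in> arcs ?R"
        "z \<in> {(tail ?R ((e, b), i), head ?R ((e, b), i)), (head ?R ((e, b), i), tail ?R ((e, b), i))}"
        by (auto simp: mk_symmetric_def)
      then show "z \<in> parcs (mk_symmetric ?U)"
        using fwd[of e b i] unfolding ends parcs_U by (auto simp del: arcs_union split: if_splits)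
    qed
    show "parcs (mk_symmetric ?U) \<subseteq> parcs (mk_symmetric ?R)"
    proof
      fix z assume "z \<in> parcs (mk_symmetric ?U)"
      then obtain e where e: "e \<in> arcs ?U" "z \<in> {(tail ?C e, head ?C e), (head ?C e, tail ?C e)}"
        unfolding parcs_U by blast
      then obtain b where b: "((e, b), 0) \<in> arcs ?R" using bwd by blast
      have "z \<in> {(tail ?R ((e, b), 0), head ?R ((e, b), 0)), (head ?R ((e, b), 0), tail ?R ((e, b), 0))}"
        using e(2) unfolding ends by auto
      then show "z \<in> parcs (mk_symmetric ?R)"
        using b unfolding mk_symmetric_def by auto
    qed
  qed
  then show ?thesis using U(4) by (simp add: mk_symmetric_def)
qed

lemma euler_path_iff:
  assumes "connecting_subgraph X N w Q"
  shows "euler_path X N w Q p \<longleftrightarrow>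
    pre_digraph.trail (replica_graph X N w Q) \<one>\<^bsub>free_group X Mod N\<^esub> p (N #>\<^bsub>free_group X\<^esub> w) \<and>
    set p = arcs (replica_graph X N w Q)"
proof -
  let ?R = "replica_graph X N w Q"
  have sub: "subgraph Q (cayley_graph X N)" using assms by (simp add: connecting_subgraph_def)
  then have Q: "tail Q = tail (cayley_graph X N)" "head Q = head (cayley_graph X N)" "wf_digraph Q"
    by (auto simp: subgraph_def compatible_def)
  have "e \<in> arcs Q \<Longrightarrow> tail (cayley_graph X N) e \<in> verts Q"
    "e \<in> arcs Q \<Longrightarrow> head (cayley_graph X N) e \<in> verts Q" for e
    using wf_digraph.tail_in_verts[OF Q(3)] wf_digraph.head_in_verts[OF Q(3)] Q(1,2) by auto
  then interpret wf_digraph ?R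
    by unfold_locales
      (auto 0 0 simp: replica_graph_def with_inverses_def Digraph_Component.union_def
        support_graph_def split: if_split_asm if_split)
  have "Digraph_Component.connected ?R"
    using assms mk_symmetric_replica_graph[OF sub]
    by (simp add: connecting_subgraph_def Digraph_Component.connected_def)
  then show ?thesis
    unfolding euler_path_def by (rule euler_trail_conv_connected)
qed

definition euler_word :: "(('a edge \<times> bool) \<times> nat) list \<Rightarrow> 'a word" where
  "euler_word p = path_label (map fst p)"

end

theory Submission
  imports Defs "HOL-Algebra.FiniteProduct"
begin

text \<open>
  The flow of a word decides its class modulo \<open>N'\<close>.  On \<open>N\<close> the flow is a homomorphism to an abelian
  group, so it vanishes on \<open>N'\<close>.  Conversely, attach to each edge from \<open>g\<close> to \<open>h\<close> with label \<open>x\<close> the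
  element \<open>s(g) x s(h)\<inverse>\<close> of \<open>N\<close>, where \<open>s\<close> is a transversal; the product of these elements along the
  path of a word depends, in the abelian group \<open>N/N'\<close>, on the flow only, and it telescopes to the
  word up to a factor that is determined by the end point.

  Hence a word \<open>u\<close> with \<open>u = w\<close> in \<open>H\<close> has the flow of \<open>w\<close>.  Its path traverses an edge \<open>e\<close> at least
  \<open>\<bar>\<pi>\<^sub>w(e)\<bar>\<close> times, and at least twice if \<open>\<pi>\<^sub>w(e) = 0\<close>, and the edges of the latter kind connect the support.
  So \<open>u\<close> is at least as long as the graph of replicas of a minimal forest is large.  An Euler path
  attains this bound, and in the case of equality the path of \<open>u\<close> uses each replica exactly once.
\<close>

section \<open>Flows, Euler trails and free reduction\<close>

lemma flow_Nil [simp]: "flow [] e = 0"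
  by (simp add: flow_def)

lemma flow_Cons:
  "flow (a # p) e = (if fst a = e then if snd a then 1 else - 1 else 0) + flow p e"
  by (cases a) (auto simp: flow_def)

lemma flow_append: "flow (p @ q) e = flow p e + flow q e"
  by (simp add: flow_def)

lemma flow_eq_0: "e \<notin> fst ` set p \<Longrightarrow> flow p e = 0"
  by (induction p) (auto simp: flow_Cons)

text \<open>Commutativity allows the factors to be sorted by edge, and opposite traversals cancel
  because the value at an inverse edge is the inverse. The set \<open>E\<close> may be larger than
  the edge set of \<open>p\<close>, so that two paths can be compared over one index set.\<close>

lemma (in comm_group) foldr_mult_eq_finprod_flow:
  assumes "finite E" "\<And>e. e \<in> E \<Longrightarrow> f (e, True) \<in> carrier G"
    and "\<And>e. e \<in> E \<Longrightarrow> f (e, False) = inv f (e, True)"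
    and "fst ` set p \<subseteq> E"
  shows "foldr (\<lambda>a c. f a \<otimes> c) p \<one> = (\<Otimes>e\<in>E. f (e, True) [^] flow p e)"
  using assms(4)
proof (induction p)
  case Nil
  then show ?case by simp
next
  case (Cons a p)
  let ?s = "\<lambda>e. (if fst a = e then if snd a then 1 else - 1 else 0) :: int"
  have a: "fst a \<in> E" using Cons.prems by simp
  have s: "f (e, True) [^] flow (a # p) e =
      (if fst a = e then f (e, snd a) else \<one>) \<otimes> f (e, True) [^] flow p e" if e: "e \<in> E" for e
  proof -
    have "f (e, True) [^] (i + j :: int) = f (e, True) [^] i \<otimes> f (e, True) [^] j" for i j
      using assms(2)[OF e] by (rule int_pow_mult)
    moreover have "f (e, True) [^] (- 1 :: int) = inv f (e, True)"
      using int_pow_neg[OF assms(2)[OF e], of 1] int_pow_1[OF assms(2)[OF e]] by simp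
    ultimately show ?thesis
      using assms(2,3)[OF e] by (cases "snd a") (simp_all add: flow_Cons)
  qed
  have closed: "f (e, b) \<in> carrier G" if "e \<in> E" for e b
    using assms(2,3)[OF that] by (cases b) simp_all
  have "(\<Otimes>e\<in>E. f (e, True) [^] flow (a # p) e) =
      (\<Otimes>e\<in>E. (if fst a = e then f (e, snd a) else \<one>) \<otimes> f (e, True) [^] flow p e)"
    by (rule finprod_cong') (use s closed in \<open>simp_all add: Pi_def\<close>)
  also have "\<dots> = (\<Otimes>e\<in>E. if fst a = e then f (e, snd a) else \<one>) \<otimes>
      (\<Otimes>e\<in>E. f (e, True) [^] flow p e)"
    by (rule finprod_multf) (use closed in \<open>simp_all add: Pi_def\<close>)
  also have "(\<Otimes>e\<in>E. if fst a = e then f (e, snd a) else \<one>) = f (fst a, snd a)"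
    by (rule finprod_singleton) (use closed a assms(1) in \<open>simp_all add: Pi_def\<close>)
  finally show ?case using Cons by simp
qed

text \<open>Reversing an edge changes the sign of its flow and swaps its ends. So every traversal
  contributes +1 at its start and -1 at its end, whatever its direction, and the sum telescopes
  along the path.\<close>

lemma flow_divergence:
  assumes "pre_digraph.cas (with_inverses \<Gamma>) g p h" "finite E" "fst ` set p \<subseteq> E"
  shows "(\<Sum>e\<in>E. flow p e * (of_bool (tail \<Gamma> e = v) - of_bool (head \<Gamma> e = v))) =
    of_bool (g = v) - of_bool (h = v)"
  using assms(1,3)
proof (induction p arbitrary: g)
  case Nil
  then show ?case by (simp add: pre_digraph.cas.simps)
next
  case (Cons a p)
  let ?d = "\<lambda>e. of_bool (tail \<Gamma> e = v) - of_bool (head \<Gamma> e = v) :: int"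
  obtain e b where a: "a = (e, b)" by force
  have "(\<Sum>e'\<in>E. flow (a # p) e' * ?d e') =
      (\<Sum>e'\<in>E. (if e = e' then (if b then 1 else - 1) * ?d e' else 0) + flow p e' * ?d e')"
    by (intro sum.cong) (auto simp: flow_Cons a algebra_simps)
  also have "\<dots> = (if b then 1 else - 1) * ?d e + (\<Sum>e'\<in>E. flow p e' * ?d e')"
    using Cons.prems assms(2) by (simp add: sum.distrib sum.delta a)
  also have "(\<Sum>e'\<in>E. flow p e' * ?d e') =
      of_bool (head (with_inverses \<Gamma>) a = v) - of_bool (h = v)"
    using Cons by (simp add: pre_digraph.cas.simps)
  finally show ?case
    using Cons.prems by (auto simp: pre_digraph.cas.simps a with_inverses_def)
qed

lemma (in fin_digraph) euler_trail_exists: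
  assumes "connected G" "u \<in> verts G" "v \<in> verts G"
    and deg: "\<And>x. x \<in> verts G \<Longrightarrow>
      int (out_degree G x) - int (in_degree G x) = of_bool (u = x) - of_bool (v = x)"
  shows "\<exists>p. euler_trail u p v"
proof (cases "u = v")
  case True
  have "in_degree G x = out_degree G x" if "x \<in> verts G" for x
    using deg[OF that] True by simp
  \<comment> \<open>The closed tour comes with an arbitrary base point \<open>x\<close>; as it
    visits every vertex, it can be rotated to start at \<open>u\<close>.\<close>
  then obtain x q where q: "trail x q x" "set q = arcs G" "set (awalk_verts x q) = verts G"
    using closed_euler1[OF assms(1)] by (auto simp: euler_trail_def)
  then obtain q' where "trail u q' u" "set q' = set q" "set (awalk_verts u q') = verts G"
    using assms(2) rotate_trailE'[OF q(1), of u] by metis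
  then have "euler_trail u q' u"
    using q(2) by (simp add: euler_trail_def)
  then show ?thesis using True by blast
next
  case False
  show ?thesis
  proof (rule open_euler1[OF assms(1-3)])
    show "in_degree G x = out_degree G x" if "x \<in> verts G" "u \<noteq> x" "v \<noteq> x" for x
      using deg[OF that(1)] that by simp
    show "in_degree G u + 1 = out_degree G u" using deg[OF assms(2)] False by simp
    show "out_degree G v + 1 = in_degree G v" using deg[OF assms(3)] False by simp
  qed
qed

text \<open>Each \<open>reduced_cons\<close> adds at most one letter, and exactly one only if
  nothing cancels. This later shows that the label of an Euler path is already reduced.\<close>

lemma length_free_reduce: "length (free_reduce w) \<le> length w"
  and free_reduce_length_eq: "length (free_reduce w) = length w \<Longrightarrow> free_reduce w = w"
proof -
  have step: "length (reduced_cons a v) \<le> Suc (length v)"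
    "length (reduced_cons a v) = Suc (length v) \<Longrightarrow> reduced_cons a v = a # v"
    for a :: "'a letter" and v
    by (cases v; auto split: if_splits)+
  have red: "free_reduce (a # w) = reduced_cons a (free_reduce w)" for a :: "'a letter" and w
    by (simp add: free_reduce_def)
  show le: "length (free_reduce w) \<le> length w" for w :: "'a word"
  proof (induction w)
    case (Cons a w)
    then show ?case using step(1)[of a "free_reduce w"] by (simp add: red)
  qed (simp add: free_reduce_def)
  show "length (free_reduce w) = length w \<Longrightarrow> free_reduce w = w"
  proof (induction w)
    case (Cons a w)
    have l: "length (reduced_cons a (free_reduce w)) = Suc (length w)"
      using Cons.prems by (simp add: red)
    then have "length (free_reduce w) = length w"
      using step(1)[of a "free_reduce w"] le[of w] by linarith
    then show ?case
      using Cons.IH step(2)[of a "free_reduce w"] l unfolding red by simp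
  qed (simp add: free_reduce_def)
qed

text \<open>Numbering the occurrences of each entry from left to right, starting with 0, separates
  them. In this way a path becomes a trail through replicas.\<close>

lemma lift_distinct:
  "\<exists>ys. map fst ys = xs \<and> distinct ys \<and> set ys = {(a, i). i < count_list xs a}"
proof (induction xs rule: rev_induct)
  case (snoc x xs)
  then obtain ys where ys: "map fst ys = xs" "distinct ys" "set ys = {(a, i). i < count_list xs a}"
    by blast
  have "{(a, i). i < count_list (xs @ [x]) a} = insert (x, count_list xs x) (set ys)"
    unfolding ys(3) by (auto simp: less_Suc_eq split: if_split_asm)
  moreover have "(x, count_list xs x) \<notin> set ys" by (simp add: ys(3))
  ultimately show ?case
    using ys(1,2) by (intro exI[of _ "ys @ [(x, count_list xs x)]"]) simp
qed auto

lemma count_list_map_fst: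
  assumes "distinct p"
  shows "count_list (map fst p) a = card {i. (a, i) \<in> set p}"
  using assms
proof (induction p)
  case (Cons x p)
  obtain b j where x: "x = (b, j)" by force
  have fin: "finite {i. (a, i) \<in> set p}"
    by (rule finite_subset[of _ "snd ` set p"]) force+
  have "{i. (a, i) \<in> set (x # p)} = (if a = b then insert j {i. (a, i) \<in> set p} else {i. (a, i) \<in> set p})"
    using x by auto
  then show ?case using Cons x fin by auto
qed simp

section \<open>Words and paths in the Cayley graph\<close>

locale free_quotient = normal N "free_group X" for X :: "'a set" and N :: "'a word set"
begin

abbreviation "F \<equiv> free_group X"
abbreviation "G \<equiv> free_group X Mod N"
abbreviation "\<Gamma> \<equiv> cayley_graph X N"
text \<open>Unreduced words are included: the label of an Euler path is not known to be reduced
  until its length has been compared with the lower bound.\<close>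

abbreviation "words \<equiv> lists (X \<times> (UNIV :: bool set))"
abbreviation "\<mu> w \<equiv> N #>\<^bsub>F\<^esub> w"
abbreviation "path \<equiv> path_from X N"

declare mult_FactGroup [simp del] one_FactGroup [simp del]

sublocale G: group G
  by (rule factorgroup_is_group)

section \<open>Cosets of words that need not be reduced\<close>

lemma mult_F: "u \<otimes>\<^bsub>F\<^esub> v = free_reduce (u @ v)"
  and one_F: "\<one>\<^bsub>F\<^esub> = []"
  and carrier_F: "w \<in> carrier F \<longleftrightarrow> w \<in> words \<and> freely_reduced w"
  by (auto simp: free_group_def)

lemma free_reduce_words: "w \<in> words \<Longrightarrow> free_reduce w \<in> words"
  using set_free_reduce[of w] by auto

lemma free_reduce_closed: "w \<in> words \<Longrightarrow> free_reduce w \<in> carrier F"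
  by (simp add: carrier_F free_reduce_words freely_reduced_free_reduce del: in_lists_conv_set)

text \<open>Multiplication in \<open>F\<close> reduces the concatenation, so the coset of an
  unreduced list is meaningful and does not see the reduction.\<close>

lemma coset_free_reduce: "\<mu> (free_reduce w) = \<mu> w"
  by (simp add: r_coset_def mult_F free_reduce_append2)

lemma coset_closed [simp]: "w \<in> words \<Longrightarrow> \<mu> w \<in> carrier G"
  using free_reduce_closed[of w] coset_free_reduce[of w, symmetric]
  by (auto simp: FactGroup_def RCOSETS_def)

lemma coset_append:
  assumes "u \<in> words" "v \<in> words"
  shows "\<mu> (u @ v) = \<mu> u \<otimes>\<^bsub>G\<^esub> \<mu> v"
proof -
  have "\<mu> u \<otimes>\<^bsub>G\<^esub> \<mu> v = \<mu> (free_reduce u) <#>\<^bsub>F\<^esub> \<mu> (free_reduce v)"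
    by (simp add: mult_FactGroup coset_free_reduce)
  also have "\<dots> = \<mu> (free_reduce (free_reduce u @ free_reduce v))"
    using rcos_sum[OF assms[THEN free_reduce_closed]] by (simp add: mult_F)
  also have "\<dots> = \<mu> (u @ v)"
    by (simp add: coset_free_reduce free_reduce_append1 free_reduce_append2)
  finally show ?thesis by simp
qed

lemma coset_Nil: "\<mu> [] = \<one>\<^bsub>G\<^esub>"
  using coset_mult_one[OF subset] by (simp add: one_F one_FactGroup)

lemma coset_Cons:
  "a \<in> X \<times> UNIV \<Longrightarrow> w \<in> words \<Longrightarrow> \<mu> (a # w) = \<mu> [a] \<otimes>\<^bsub>G\<^esub> \<mu> w"
  using coset_append[of "[a]" w] by simp

lemma inv_letter_closed: "a \<in> X \<times> UNIV \<Longrightarrow> inv_letter a \<in> X \<times> UNIV"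
  by (auto simp: inv_letter_def)

lemma coset_inv_letter:
  assumes "a \<in> X \<times> UNIV"
  shows "\<mu> [inv_letter a] = inv\<^bsub>G\<^esub> \<mu> [a]"
proof -
  have "\<mu> [inv_letter a] \<otimes>\<^bsub>G\<^esub> \<mu> [a] = \<mu> ([inv_letter a] @ [a])"
    using assms inv_letter_closed[OF assms] by (intro coset_append[symmetric]) auto
  also have "\<dots> = \<mu> (free_reduce ([inv_letter a] @ [a]))" by (simp only: coset_free_reduce)
  also have "\<dots> = \<one>\<^bsub>G\<^esub>" by (simp add: free_reduce_def coset_Nil)
  finally show ?thesis
    using assms inv_letter_closed[OF assms] by (intro G.inv_equality[symmetric] coset_closed) auto
qed

text \<open>The oriented edge along which the letter \<open>a\<close> leaves \<open>g\<close>. For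
  an inverse letter the underlying positive edge starts at the vertex that is reached. This gives
  \<open>path\<close> one recursion for both signs.\<close>

definition step_edge :: "'a vertex \<Rightarrow> 'a letter \<Rightarrow> 'a edge \<times> bool" where
  "step_edge g a = ((if snd a then g else g \<otimes>\<^bsub>G\<^esub> \<mu> [a], fst a), snd a)"

lemma path_Cons:
  assumes "a \<in> X \<times> UNIV"
  shows "path g (a # w) = step_edge g a # path (g \<otimes>\<^bsub>G\<^esub> \<mu> [a]) w"
proof (cases "snd a")
  case False
  then obtain x where "a = (x, False)" by (cases a) auto
  then show ?thesis
    using coset_inv_letter[of "(x, True)"] assms by (simp add: step_edge_def Let_def inv_letter_def)
qed (use assms in \<open>cases a; simp add: step_edge_def\<close>)

lemma path_append:
  assumes "u \<in> words" "v \<in> words" "g \<in> carrier G"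
  shows "path g (u @ v) = path g u @ path (g \<otimes>\<^bsub>G\<^esub> \<mu> u) v"
  using assms(1,3)
proof (induction u arbitrary: g)
  case Nil
  then show ?case by (simp add: coset_Nil)
next
  case (Cons a u)
  then have a: "a \<in> X \<times> UNIV" and u: "u \<in> words" by auto
  have m: "\<mu> [a] \<in> carrier G" "\<mu> u \<in> carrier G"
    using a u by (auto intro: coset_closed)
  have "path (g \<otimes>\<^bsub>G\<^esub> \<mu> [a]) (u @ v) =
      path (g \<otimes>\<^bsub>G\<^esub> \<mu> [a]) u @ path (g \<otimes>\<^bsub>G\<^esub> \<mu> [a] \<otimes>\<^bsub>G\<^esub> \<mu> u) v"
    using Cons.IH Cons.prems m by simp
  then show ?case
    using Cons.prems m by (simp add: path_Cons[OF a] coset_Cons[OF a u] G.m_assoc)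
qed

lemma step_edge_ends:
  assumes "a \<in> X \<times> UNIV" "g \<in> carrier G"
  shows "tail (with_inverses \<Gamma>) (step_edge g a) = g"
    and "head (with_inverses \<Gamma>) (step_edge g a) = g \<otimes>\<^bsub>G\<^esub> \<mu> [a]"
    and "step_edge g a \<in> arcs (with_inverses \<Gamma>)"
proof -
  have a: "\<mu> [a] \<in> carrier G" using assms by (intro coset_closed) simp
  have "g \<otimes>\<^bsub>G\<^esub> \<mu> [a] \<otimes>\<^bsub>G\<^esub> \<mu> [(fst a, True)] = g" if "\<not> snd a"
  proof -
    have "inv_letter a = (fst a, True)" using that by (simp add: inv_letter_def)
    then show ?thesis using coset_inv_letter[OF assms(1)] assms(2) a by (simp add: G.m_assoc)
  qed
  then show "tail (with_inverses \<Gamma>) (step_edge g a) = g"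
    "head (with_inverses \<Gamma>) (step_edge g a) = g \<otimes>\<^bsub>G\<^esub> \<mu> [a]"
    "step_edge g a \<in> arcs (with_inverses \<Gamma>)"
    using assms a by (auto simp: step_edge_def with_inverses_def cayley_graph_def)
qed

text \<open>An oriented edge of the Cayley graph is determined by its origin and its label, since
  right multiplication by a generator is invertible.\<close>

lemma step_edge_tail:
  assumes "b \<in> arcs (with_inverses \<Gamma>)" "tail (with_inverses \<Gamma>) b = g"
  shows "step_edge g (edge_label b) = b" "edge_label b \<in> X \<times> UNIV"
proof -
  obtain h x d where b: "b = ((h, x), d)" by (metis prod.collapse)
  have h: "h \<in> carrier G" "x \<in> X" using assms(1) by (auto simp: with_inverses_def cayley_graph_def b)
  have "h \<otimes>\<^bsub>G\<^esub> \<mu> [(x, True)] \<otimes>\<^bsub>G\<^esub> \<mu> [(x, False)] = h"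
  proof -
    have "\<mu> [(x, False)] = inv\<^bsub>G\<^esub> \<mu> [(x, True)]"
      using coset_inv_letter[of "(x, True)"] h by (simp add: inv_letter_def)
    moreover have "\<mu> [(x, True)] \<in> carrier G" using h by (intro coset_closed) simp
    ultimately show ?thesis using h by (simp add: G.m_assoc)
  qed
  then show "step_edge g (edge_label b) = b"
    using assms(2) by (cases d) (auto simp: b step_edge_def edge_label_def with_inverses_def cayley_graph_def)
  show "edge_label b \<in> X \<times> UNIV" using h by (simp add: b edge_label_def)
qed

text \<open>As an oriented edge is determined by origin and label, walking along the label of a path
  from the same start retraces the path. Thus the flow of an Euler path is the flow of its
  label.\<close>

lemma path_of_label:
  assumes "pre_digraph.cas (with_inverses \<Gamma>) g p h" "set p \<subseteq> arcs (with_inverses \<Gamma>)" "g \<in> carrier G"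
  shows "path_label p \<in> words \<and> path g (path_label p) = p \<and> h = g \<otimes>\<^bsub>G\<^esub> \<mu> (path_label p)"
  using assms
proof (induction p arbitrary: g)
  case Nil
  then show ?case by (simp add: path_label_def pre_digraph.cas.simps coset_Nil)
next
  case (Cons b p)
  let ?a = "edge_label b"
  have b: "b \<in> arcs (with_inverses \<Gamma>)" "tail (with_inverses \<Gamma>) b = g"
    using Cons.prems by (auto simp: pre_digraph.cas.simps)
  note a = step_edge_tail[OF b]
  have hd: "head (with_inverses \<Gamma>) b = g \<otimes>\<^bsub>G\<^esub> \<mu> [?a]"
    using step_edge_ends(2)[OF a(2) Cons.prems(3)] a(1) by simp
  have a': "\<mu> [?a] \<in> carrier G" using a(2) by (intro coset_closed) simp
  have IH: "path_label p \<in> words \<and> path (g \<otimes>\<^bsub>G\<^esub> \<mu> [?a]) (path_label p) = p \<and>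
      h = g \<otimes>\<^bsub>G\<^esub> \<mu> [?a] \<otimes>\<^bsub>G\<^esub> \<mu> (path_label p)"
    using Cons.prems hd a' by (intro Cons.IH) (auto simp: pre_digraph.cas.simps)
  have split: "path_label (b # p) = ?a # path_label p" by (simp add: path_label_def)
  have "\<mu> (path_label p) \<in> carrier G" using IH by (intro coset_closed) blast
  then have h: "h = g \<otimes>\<^bsub>G\<^esub> \<mu> (?a # path_label p)"
    using IH a' Cons.prems(3) coset_Cons[OF a(2), of "path_label p"] by (simp add: G.m_assoc)
  have "path g (?a # path_label p) = b # p"
    using path_Cons[OF a(2)] a(1) IH by simp
  then show ?case
    using IH a(2) h unfolding split by auto
qed

text \<open>The analogue of \<open>awalk_path_from\<close> for words that need not be
  reduced.\<close>

lemma path_cas: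
  assumes "w \<in> words" "g \<in> carrier G"
  shows "pre_digraph.cas (with_inverses \<Gamma>) g (path g w) (g \<otimes>\<^bsub>G\<^esub> \<mu> w) \<and>
    set (path g w) \<subseteq> arcs (with_inverses \<Gamma>)"
  using assms
proof (induction w arbitrary: g)
  case Nil
  then show ?case by (simp add: pre_digraph.cas.simps coset_Nil)
next
  case (Cons a w)
  then have a: "a \<in> X \<times> UNIV" and w: "w \<in> words" by auto
  have "\<mu> [a] \<in> carrier G" "\<mu> w \<in> carrier G" using a w by (auto intro: coset_closed)
  then show ?case
    using Cons.IH[of "g \<otimes>\<^bsub>G\<^esub> \<mu> [a]"] step_edge_ends[OF a Cons.prems] Cons.prems
    by (simp add: path_Cons[OF a] coset_Cons[OF a w] pre_digraph.cas.simps G.m_assoc)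
qed

text \<open>The second letter runs back along the edge just traversed, so the two contributions
  cancel and the walk resumes at \<open>g\<close>.\<close>

lemma flow_path_cancel:
  assumes "a \<in> X \<times> UNIV" "g \<in> carrier G"
  shows "flow (path g (a # inv_letter a # w)) = flow (path g w)"
proof -
  have m: "\<mu> [a] \<in> carrier G" using assms by (intro coset_closed) simp
  have g: "g \<otimes>\<^bsub>G\<^esub> \<mu> [a] \<otimes>\<^bsub>G\<^esub> \<mu> [inv_letter a] = g"
    using m assms(2) coset_inv_letter[OF assms(1)] by (simp add: G.m_assoc)
  have "fst (inv_letter a) = fst a" "snd (inv_letter a) = (\<not> snd a)"
    by (simp_all add: inv_letter_def)
  then have "step_edge (g \<otimes>\<^bsub>G\<^esub> \<mu> [a]) (inv_letter a) = (fst (step_edge g a), \<not> snd a)"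
    by (simp add: step_edge_def g)
  moreover have "snd (step_edge g a) = snd a" by (simp add: step_edge_def)
  ultimately show ?thesis
    by (simp add: path_Cons[OF assms(1)] path_Cons[OF inv_letter_closed[OF assms(1)]] g
        flow_Cons fun_eq_iff)
qed

lemma flow_path_free_reduce:
  assumes "w \<in> words" "g \<in> carrier G"
  shows "flow (path g (free_reduce w)) = flow (path g w)"
  using assms
proof (induction w arbitrary: g)
  case Nil
  then show ?case by (simp add: free_reduce_def)
next
  case (Cons a w)
  then have a: "a \<in> X \<times> UNIV" and w: "w \<in> words" by auto
  have m: "\<mu> [a] \<in> carrier G" using a by (intro coset_closed) simp
  have IH: "flow (path (g \<otimes>\<^bsub>G\<^esub> \<mu> [a]) (free_reduce w)) = flow (path (g \<otimes>\<^bsub>G\<^esub> \<mu> [a]) w)"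
    using Cons.IH Cons.prems m by simp
  have step: "flow (path g (reduced_cons a v)) = flow (path g (a # v))" for v
    by (cases v) (auto simp: flow_path_cancel[OF a Cons.prems])
  have "free_reduce (a # w) = reduced_cons a (free_reduce w)" by (simp add: free_reduce_def)
  then show ?case
    using IH step[of "free_reduce w"] by (simp add: path_Cons[OF a] flow_Cons fun_eq_iff)
qed

abbreviation wflow :: "'a word \<Rightarrow> 'a edge \<Rightarrow> int" where "wflow \<equiv> word_flow X N"

lemma word_flow_free_reduce: "w \<in> words \<Longrightarrow> wflow (free_reduce w) = wflow w"
  by (simp add: word_flow_def word_path_def flow_path_free_reduce)

section \<open>The flow on \<open>N\<close> and on its commutator subgroup\<close>

lemma N_eq_coset: "n \<in> N \<Longrightarrow> \<mu> n = \<one>\<^bsub>G\<^esub>"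
  by (simp add: one_FactGroup rcos_const)

text \<open>The path of \<open>n\<close> is closed, so the path of \<open>u\<close> after it starts
  at the identity again.\<close>

lemma word_flow_mult_N:
  assumes "n \<in> N" "u \<in> carrier F"
  shows "wflow (n \<otimes>\<^bsub>F\<^esub> u) e = wflow n e + wflow u e"
proof -
  have n: "n \<in> words" and u: "u \<in> words" using assms subset carrier_F by auto
  then have "wflow (n \<otimes>\<^bsub>F\<^esub> u) e = wflow (n @ u) e"
    by (simp add: mult_F word_flow_free_reduce)
  also have "\<dots> = wflow n e + wflow u e"
    using n u N_eq_coset[OF assms(1)] by (simp add: word_flow_def word_path_def path_append flow_append)
  finally show ?thesis .
qed

lemma word_flow_one: "wflow \<one>\<^bsub>F\<^esub> e = 0"
  by (simp add: one_F word_flow_def word_path_def)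

lemma word_flow_inv_N:
  assumes "n \<in> N"
  shows "wflow (inv\<^bsub>F\<^esub> n) e = - wflow n e"
proof -
  have "n \<otimes>\<^bsub>F\<^esub> inv\<^bsub>F\<^esub> n = \<one>\<^bsub>F\<^esub>" using assms by simp
  then show ?thesis
    using word_flow_mult_N[of n "inv\<^bsub>F\<^esub> n" e] assms word_flow_one[of e] by simp
qed

abbreviation "D \<equiv> derived F N"

sublocale D: normal D F
  by (rule derived_is_normal[OF normal_axioms])

lemma D_subset: "D \<subseteq> N"
  by (rule derived_incl[OF order_refl subgroup_axioms])

lemma word_flow_derived:
  assumes "d \<in> D"
  shows "wflow d e = 0"
proof -
  \<comment> \<open>Membership in \<open>N\<close> is carried through the induction because
    additivity of the flow requires it of the left factor. On a commutator the four contributions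
    cancel.\<close>
  have "d \<in> N \<and> wflow d e = 0"
    using assms unfolding derived_def
  proof (induction rule: generate.induct)
    case one
    then show ?case by (simp add: word_flow_one)
  next
    case (incl h)
    then show ?case by (auto simp: word_flow_mult_N word_flow_inv_N)
  next
    case (inv h)
    then show ?case by (auto simp: word_flow_mult_N word_flow_inv_N)
  next
    case (eng h1 h2)
    then show ?case by (simp add: word_flow_mult_N)
  qed
  then show ?thesis ..
qed

text \<open>The factor from \<open>D\<close> by which the two words differ has zero flow.\<close>

lemma word_flow_eq_if_coset_eq:
  assumes "u \<in> carrier F" "v \<in> carrier F" "D #>\<^bsub>F\<^esub> u = D #>\<^bsub>F\<^esub> v"
  shows "wflow u = wflow v"
proof -
  have "u \<in> D #>\<^bsub>F\<^esub> v" using rcos_self[OF assms(1) D.subgroup_axioms] assms(3) by simp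
  then obtain d where "d \<in> D" "u = d \<otimes>\<^bsub>F\<^esub> v" by (auto simp: r_coset_def)
  then show ?thesis
    using subsetD[OF D_subset, of d] assms(2)
    by (simp add: fun_eq_iff word_flow_mult_N word_flow_derived)
qed

section \<open>The flow determines the class modulo the commutator subgroup\<close>

lemma group_hom_coset: "group_hom F G (\<lambda>w. \<mu> w)"
  by (intro group_hom.intro group_axioms G.group_axioms group_hom_axioms.intro r_coset_hom_Mod)

text \<open>A transversal of \<open>N\<close> in \<open>F\<close>, normalised at the identity so
  that \<open>cocycle\<close> based there starts with the word itself.\<close>

definition rep :: "'a vertex \<Rightarrow> 'a word" where
  "rep g = (if g = \<one>\<^bsub>G\<^esub> then [] else SOME s. s \<in> carrier F \<and> \<mu> s = g)"

lemma rep: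
  assumes "g \<in> carrier G"
  shows "rep g \<in> carrier F" "\<mu> (rep g) = g"
proof -
  have "\<exists>s. s \<in> carrier F \<and> \<mu> s = g"
    using assms by (auto simp: FactGroup_def RCOSETS_def)
  then have "(SOME s. s \<in> carrier F \<and> \<mu> s = g) \<in> carrier F \<and>
      \<mu> (SOME s. s \<in> carrier F \<and> \<mu> s = g) = g"
    by (rule someI_ex)
  then show "rep g \<in> carrier F" "\<mu> (rep g) = g"
    by (auto simp: rep_def carrier_F coset_Nil)
qed

text \<open>For \<open>w\<close> a letter these are the Schreier generators of \<open>N\<close>.\<close>

definition cocycle :: "'a vertex \<Rightarrow> 'a word \<Rightarrow> 'a word" where
  "cocycle g w = rep g \<otimes>\<^bsub>F\<^esub> free_reduce w \<otimes>\<^bsub>F\<^esub> inv\<^bsub>F\<^esub> rep (g \<otimes>\<^bsub>G\<^esub> \<mu> w)"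

lemma cocycle_in_N:
  assumes "w \<in> words" "g \<in> carrier G"
  shows "cocycle g w \<in> N"
proof -
  interpret h: group_hom F G "\<lambda>w. \<mu> w" by (rule group_hom_coset)
  have w: "free_reduce w \<in> carrier F" "\<mu> w \<in> carrier G"
    using free_reduce_closed[OF assms(1)] coset_closed[OF assms(1)] .
  define k where "k = g \<otimes>\<^bsub>G\<^esub> \<mu> w"
  have k: "k \<in> carrier G" using assms(2) w by (simp add: k_def)
  have "\<mu> (cocycle g w) = k \<otimes>\<^bsub>G\<^esub> inv\<^bsub>G\<^esub> k"
    using rep[OF assms(2)] rep[OF k] w unfolding cocycle_def k_def[symmetric]
    by (simp add: coset_free_reduce k_def)
  then have "\<mu> (cocycle g w) = N" using k by (simp add: one_FactGroup)
  moreover have "cocycle g w \<in> carrier F"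
    using rep[OF assms(2)] rep[OF k] w unfolding cocycle_def k_def[symmetric] by simp
  ultimately show ?thesis by (intro coset_join1[OF _ _ subgroup_axioms])
qed

text \<open>The representative of the intermediate vertex \<open>h\<close> cancels; this is the
  telescoping along a path.\<close>

lemma cocycle_append:
  assumes "u \<in> words" "v \<in> words" "g \<in> carrier G"
  shows "cocycle g (u @ v) = cocycle g u \<otimes>\<^bsub>F\<^esub> cocycle (g \<otimes>\<^bsub>G\<^esub> \<mu> u) v"
proof -
  have m: "\<mu> u \<in> carrier G" "\<mu> v \<in> carrier G" using assms by (auto intro: coset_closed)
  define h k where "h = g \<otimes>\<^bsub>G\<^esub> \<mu> u" and "k = h \<otimes>\<^bsub>G\<^esub> \<mu> v"
  have r: "rep g \<in> carrier F" "rep h \<in> carrier F" "rep k \<in> carrier F"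
    using assms(3) m by (simp_all add: rep h_def k_def)
  have f: "free_reduce u \<in> carrier F" "free_reduce v \<in> carrier F"
    using assms(1,2)[THEN free_reduce_closed] .
  have cancel: "inv\<^bsub>F\<^esub> rep h \<otimes>\<^bsub>F\<^esub> (rep h \<otimes>\<^bsub>F\<^esub> z) = z" if "z \<in> carrier F" for z
    using that r by (simp flip: m_assoc)
  have "free_reduce (u @ v) = free_reduce u \<otimes>\<^bsub>F\<^esub> free_reduce v"
    by (simp add: mult_F free_reduce_append1 free_reduce_append2)
  moreover have "g \<otimes>\<^bsub>G\<^esub> \<mu> (u @ v) = k"
    using m assms by (simp add: coset_append[OF assms(1,2)] h_def k_def G.m_assoc)
  ultimately have "cocycle g (u @ v) =
      rep g \<otimes>\<^bsub>F\<^esub> (free_reduce u \<otimes>\<^bsub>F\<^esub> free_reduce v) \<otimes>\<^bsub>F\<^esub> inv\<^bsub>F\<^esub> rep k"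
    by (simp add: cocycle_def)
  also have "\<dots> = rep g \<otimes>\<^bsub>F\<^esub> free_reduce u \<otimes>\<^bsub>F\<^esub> inv\<^bsub>F\<^esub> rep h \<otimes>\<^bsub>F\<^esub>
      (rep h \<otimes>\<^bsub>F\<^esub> free_reduce v \<otimes>\<^bsub>F\<^esub> inv\<^bsub>F\<^esub> rep k)"
    using r f by (simp add: m_assoc cancel)
  also have "\<dots> = cocycle g u \<otimes>\<^bsub>F\<^esub> cocycle h v"
    by (simp add: cocycle_def h_def k_def)
  finally show ?thesis by (simp add: h_def)
qed

lemma cocycle_trivial:
  assumes "free_reduce w = []" "g \<in> carrier G"
  shows "cocycle g w = \<one>\<^bsub>F\<^esub>"
proof -
  have "\<mu> w = \<one>\<^bsub>G\<^esub>"
    using coset_free_reduce[of w] unfolding assms(1) coset_Nil by (rule sym)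
  then have "g \<otimes>\<^bsub>G\<^esub> \<mu> w = g"
    using assms(2) by simp
  then show ?thesis
    using rep[OF assms(2)] r_one[of "rep g"] by (simp add: cocycle_def assms(1) one_F)
qed

text \<open>Products over edges need a commutative group, which \<open>F Mod D\<close> need not be;
  hence the carrier is cut down to \<open>N\<close> before the quotient is formed.\<close>

abbreviation "A \<equiv> F\<lparr>carrier := N\<rparr> Mod D"

text \<open>Restricting the carrier to \<open>N\<close> changes neither the cosets nor the
  commutator subgroup, so products in \<open>A\<close> can be computed with cosets in
  \<open>F\<close>.\<close>

lemma
  shows comm_group_A: "comm_group A"
    and coset_in_A: "n \<in> N \<Longrightarrow> D #>\<^bsub>F\<^esub> n \<in> carrier A"
    and coset_mult_A: "m \<in> N \<Longrightarrow> n \<in> N \<Longrightarrow>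
      (D #>\<^bsub>F\<^esub> m) \<otimes>\<^bsub>A\<^esub> (D #>\<^bsub>F\<^esub> n) = D #>\<^bsub>F\<^esub> (m \<otimes>\<^bsub>F\<^esub> n)"
    and coset_one_A: "D #>\<^bsub>F\<^esub> \<one>\<^bsub>F\<^esub> = \<one>\<^bsub>A\<^esub>"
proof -
  interpret K: group "F\<lparr>carrier := N\<rparr>" by (rule subgroup_imp_group[OF subgroup_axioms])
  have coset: "D #>\<^bsub>F\<lparr>carrier := N\<rparr>\<^esub> n = D #>\<^bsub>F\<^esub> n" for n
    by (simp add: r_coset_def)
  have D: "derived (F\<lparr>carrier := N\<rparr>) N = D"
    by (rule derived_consistent[OF order_refl subgroup_axioms])
  show "comm_group A" using K.derived_quot_is_comm_group by (simp add: D)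
  interpret DK: normal D "F\<lparr>carrier := N\<rparr>"
    by (rule derived_subgroup_is_normal[OF subgroup_axioms])
  show "D #>\<^bsub>F\<^esub> n \<in> carrier A" if "n \<in> N"
    using that coset[symmetric] by (auto simp: FactGroup_def RCOSETS_def)
  show "(D #>\<^bsub>F\<^esub> m) \<otimes>\<^bsub>A\<^esub> (D #>\<^bsub>F\<^esub> n) = D #>\<^bsub>F\<^esub> (m \<otimes>\<^bsub>F\<^esub> n)"
    if "m \<in> N" "n \<in> N"
    using DK.rcos_sum[of m n] that by (simp add: mult_FactGroup coset)
  show "D #>\<^bsub>F\<^esub> \<one>\<^bsub>F\<^esub> = \<one>\<^bsub>A\<^esub>"
    using coset_mult_one[OF D.subset] by (simp add: one_FactGroup)
qed

text \<open>Inverse edges receive the inverse value by definition, as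
  \<open>foldr_mult_eq_finprod_flow\<close> demands; that this agrees with the cocycle of an inverse
  letter is shown separately.\<close>

definition edge_weight :: "'a edge \<times> bool \<Rightarrow> 'a word set" where
  "edge_weight a = (let y = D #>\<^bsub>F\<^esub> cocycle (fst (fst a)) [(snd (fst a), True)]
     in if snd a then y else inv\<^bsub>A\<^esub> y)"

text \<open>For an inverse letter, going along it and back has trivial cocycle, so the cosets of the
  two single steps are inverse to each other.\<close>

lemma edge_weight_step_edge:
  assumes "a \<in> X \<times> UNIV" "g \<in> carrier G"
  shows "edge_weight (step_edge g a) = D #>\<^bsub>F\<^esub> cocycle g [a]"
proof (cases "snd a")
  case True
  then show ?thesis by (cases a) (simp add: edge_weight_def step_edge_def Let_def)
next
  case False
  interpret A: comm_group A by (rule comm_group_A)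
  let ?h = "g \<otimes>\<^bsub>G\<^esub> \<mu> [a]"
  have ia: "inv_letter a = (fst a, True)" using False by (simp add: inv_letter_def)
  have w: "[a] \<in> words" "[inv_letter a] \<in> words"
    using assms inv_letter_closed[OF assms(1)] by auto
  have h: "?h \<in> carrier G" using assms(2) coset_closed[OF w(1)] by simp
  have "cocycle g [a] \<otimes>\<^bsub>F\<^esub> cocycle ?h [inv_letter a] = cocycle g ([a] @ [inv_letter a])"
    using cocycle_append[OF w assms(2)] by simp
  also have "\<dots> = \<one>\<^bsub>F\<^esub>"
    by (rule cocycle_trivial[OF _ assms(2)]) (simp add: free_reduce_def)
  finally have "(D #>\<^bsub>F\<^esub> cocycle g [a]) \<otimes>\<^bsub>A\<^esub> (D #>\<^bsub>F\<^esub> cocycle ?h [inv_letter a]) = \<one>\<^bsub>A\<^esub>"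
    using cocycle_in_N[OF w(1) assms(2)] cocycle_in_N[OF w(2) h] by (simp add: coset_mult_A coset_one_A)
  then have "inv\<^bsub>A\<^esub> (D #>\<^bsub>F\<^esub> cocycle ?h [inv_letter a]) = D #>\<^bsub>F\<^esub> cocycle g [a]"
    using cocycle_in_N[OF w(1) assms(2)] cocycle_in_N[OF w(2) h]
    by (intro A.inv_equality coset_in_A)
  then show ?thesis
    using False by (simp add: edge_weight_def step_edge_def Let_def ia)
qed

lemma coset_cocycle:
  assumes "w \<in> words" "g \<in> carrier G"
  shows "D #>\<^bsub>F\<^esub> cocycle g w =
    foldr (\<lambda>a c. edge_weight a \<otimes>\<^bsub>A\<^esub> c) (path g w) \<one>\<^bsub>A\<^esub>"
  using assms
proof (induction w arbitrary: g)
  case Nil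
  then show ?case
    using cocycle_trivial[of "[]"] coset_one_A by (simp add: free_reduce_def)
next
  case (Cons a w)
  have w: "[a] \<in> words" "w \<in> words" using Cons.hyps by auto
  let ?h = "g \<otimes>\<^bsub>G\<^esub> \<mu> [a]"
  have h: "?h \<in> carrier G" using Cons.prems coset_closed[OF w(1)] by simp
  have "D #>\<^bsub>F\<^esub> cocycle g (a # w) =
      (D #>\<^bsub>F\<^esub> cocycle g [a]) \<otimes>\<^bsub>A\<^esub> (D #>\<^bsub>F\<^esub> cocycle ?h w)"
    using cocycle_append[OF w Cons.prems] cocycle_in_N[OF w(1) Cons.prems] cocycle_in_N[OF w(2) h]
    by (simp add: coset_mult_A)
  then show ?case
    using Cons.IH[OF h] path_Cons[OF Cons.hyps(1)] edge_weight_step_edge[OF Cons.hyps(1) Cons.prems]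
    by simp
qed

lemma path_edges: "w \<in> words \<Longrightarrow> g \<in> carrier G \<Longrightarrow> fst ` set (path g w) \<subseteq> arcs \<Gamma>"
  using path_cas[of w g] by (auto simp: with_inverses_def)

text \<open>The converse of \<open>word_flow_eq_if_coset_eq\<close>. Equality in \<open>G\<close>
  comes first, because the telescoped product carries a factor depending on the end point.\<close>

lemma coset_eq_if_word_flow_eq:
  assumes "u \<in> carrier F" "v \<in> carrier F" "wflow u = wflow v"
  shows "\<mu> u = \<mu> v" "D #>\<^bsub>F\<^esub> u = D #>\<^bsub>F\<^esub> v"
proof -
  interpret A: comm_group A by (rule comm_group_A)
  have w: "u \<in> words" "v \<in> words" using assms carrier_F by auto
  have flow: "flow (path \<one>\<^bsub>G\<^esub> u) = flow (path \<one>\<^bsub>G\<^esub> v)"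
    using assms(3) by (simp add: word_flow_def word_path_def)
  define E where "E = fst ` set (path \<one>\<^bsub>G\<^esub> u) \<union> fst ` set (path \<one>\<^bsub>G\<^esub> v)"
  have E: "finite E" "E \<subseteq> arcs \<Gamma>" using path_edges w by (auto simp: E_def)
  note cas = conjunct1[OF path_cas[OF _ G.one_closed]]
  \<comment> \<open>The divergence at the vertex \<open>\<mu> u\<close> detects whether a path ends
    there, and it is the same for both words.\<close>
  have "of_bool (\<one>\<^bsub>G\<^esub> = \<mu> u) - of_bool (\<one>\<^bsub>G\<^esub> \<otimes>\<^bsub>G\<^esub> \<mu> u = \<mu> u) =
      (of_bool (\<one>\<^bsub>G\<^esub> = \<mu> u) - of_bool (\<one>\<^bsub>G\<^esub> \<otimes>\<^bsub>G\<^esub> \<mu> v = \<mu> u) :: int)"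
    using flow_divergence[OF cas[OF w(1)] E(1)] flow_divergence[OF cas[OF w(2)] E(1)]
    unfolding flow E_def by auto
  then show \<mu>: "\<mu> u = \<mu> v"
    using coset_closed[OF w(1)] coset_closed[OF w(2)] by (simp add: of_bool_def split: if_splits)
  have weight: "edge_weight (e, True) \<in> carrier A"
    "edge_weight (e, False) = inv\<^bsub>A\<^esub> edge_weight (e, True)" if "e \<in> E" for e
  proof -
    have "fst e \<in> carrier G" "snd e \<in> X" using E(2) that by (auto simp: cayley_graph_def)
    then show "edge_weight (e, True) \<in> carrier A"
      by (auto simp: edge_weight_def intro!: coset_in_A cocycle_in_N)
  qed (simp add: edge_weight_def Let_def)
  \<comment> \<open>Both sides are the product over \<open>E\<close> of the edge weights raised to
    the common flow.\<close>
  have "D #>\<^bsub>F\<^esub> cocycle \<one>\<^bsub>G\<^esub> u = D #>\<^bsub>F\<^esub> cocycle \<one>\<^bsub>G\<^esub> v"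
    using A.foldr_mult_eq_finprod_flow[OF E(1) weight, of "path \<one>\<^bsub>G\<^esub> u"]
      A.foldr_mult_eq_finprod_flow[OF E(1) weight, of "path \<one>\<^bsub>G\<^esub> v"] w
    by (simp add: coset_cocycle flow E_def)
  moreover define r where "r = rep (\<mu> u)"
  have r: "r \<in> carrier F" using rep coset_closed[OF w(1)] by (simp add: r_def)
  \<comment> \<open>As \<open>rep\<close> is empty at the identity, the cocycle is the word times
    the inverse of \<open>r\<close>; multiplying by \<open>r\<close> on the right then recovers the
    word.\<close>
  moreover have "cocycle \<one>\<^bsub>G\<^esub> s = s \<otimes>\<^bsub>F\<^esub> inv\<^bsub>F\<^esub> r"
    if "s \<in> carrier F" "\<mu> s = \<mu> u" for s
  proof -
    have "free_reduce s = s" "s \<in> words" using that(1) by (auto simp: carrier_F free_reduce_id)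
    then show ?thesis
      using that coset_closed[of s] l_one[OF that(1)] by (simp add: cocycle_def rep_def r_def one_F)
  qed
  ultimately have "(D #>\<^bsub>F\<^esub> (u \<otimes>\<^bsub>F\<^esub> inv\<^bsub>F\<^esub> r)) #>\<^bsub>F\<^esub> r = (D #>\<^bsub>F\<^esub> (v \<otimes>\<^bsub>F\<^esub> inv\<^bsub>F\<^esub> r)) #>\<^bsub>F\<^esub> r"
    using assms(1,2) \<mu> by simp
  then show "D #>\<^bsub>F\<^esub> u = D #>\<^bsub>F\<^esub> v"
    using assms(1,2) r by (simp add: coset_mult_assoc[OF D.subset] m_assoc)
qed

end

section \<open>The graph of replicas\<close>

text \<open>A traversal in either direction is an adjacency in the symmetric graph. The ends of all
  traversed edges are recorded too, since connectedness asks for every vertex and not only for the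
  last one.\<close>

lemma (in wf_digraph) reachable_with_inverses:
  assumes "pre_digraph.cas (with_inverses G) g p h" "fst ` set p \<subseteq> arcs G" "g \<in> verts G"
  shows "g \<rightarrow>\<^sup>*\<^bsub>mk_symmetric G\<^esub> h \<and>
    (\<forall>e\<in>fst ` set p. g \<rightarrow>\<^sup>*\<^bsub>mk_symmetric G\<^esub> tail G e \<and> g \<rightarrow>\<^sup>*\<^bsub>mk_symmetric G\<^esub> head G e)"
proof -
  interpret S: pair_wf_digraph "mk_symmetric G" by (rule wellformed_mk_symmetric)
  show ?thesis using assms
  proof (induction p arbitrary: g)
    case Nil
    then show ?case by (simp add: pre_digraph.cas.simps S.reachable_refl)
  next
    case (Cons a p)
    obtain e b where a: "a = (e, b)" by force
    define k where "k = head (with_inverses G) a"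
    have e: "e \<in> arcs G" using Cons.prems(2) by (simp add: a)
    have g: "tail (with_inverses G) a = g" and cas: "pre_digraph.cas (with_inverses G) k p h"
      using Cons.prems(1) by (simp_all add: pre_digraph.cas.simps k_def)
    have gk: "(g, k) \<in> {(tail G e, head G e), (head G e, tail G e)}"
      using g by (auto simp: k_def a with_inverses_def)
    then have "(g, k) \<in> parcs (mk_symmetric G)"
      using e unfolding parcs_mk_symmetric by blast
    then have adj: "g \<rightarrow>\<^sup>*\<^bsub>mk_symmetric G\<^esub> k"
      by (intro S.reachable_adjI) simp
    have k: "k \<in> verts G" using gk e by auto
    have gg: "g \<rightarrow>\<^sup>*\<^bsub>mk_symmetric G\<^esub> g"
      using Cons.prems(3) by (simp add: S.reachable_refl)
    have IH: "k \<rightarrow>\<^sup>*\<^bsub>mk_symmetric G\<^esub> h"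
      "\<And>e. e \<in> fst ` set p \<Longrightarrow>
        k \<rightarrow>\<^sup>*\<^bsub>mk_symmetric G\<^esub> tail G e \<and> k \<rightarrow>\<^sup>*\<^bsub>mk_symmetric G\<^esub> head G e"
      using Cons.IH[OF cas _ k] Cons.prems(2) by auto
    have "g \<rightarrow>\<^sup>*\<^bsub>mk_symmetric G\<^esub> tail G e \<and> g \<rightarrow>\<^sup>*\<^bsub>mk_symmetric G\<^esub> head G e"
      using gk adj gg by auto
    then show ?case
      using IH S.reachable_trans[OF adj] by (auto simp: a)
  qed
qed

text \<open>Meant for edges of the support and of the forest only; the latter are those with zero flow.\<close>

definition replica_count :: "('e \<Rightarrow> int) \<Rightarrow> 'e \<times> bool \<Rightarrow> nat" where
  "replica_count \<pi> a =
    (if \<pi> (fst a) = 0 then 1 else nat (if snd a then \<pi> (fst a) else - \<pi> (fst a)))"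

lemma replica_count_diff: "int (replica_count \<pi> (e, True)) - int (replica_count \<pi> (e, False)) = \<pi> e"
  by (simp add: replica_count_def)

lemma replica_count_add:
  "int (replica_count \<pi> (e, True)) + int (replica_count \<pi> (e, False)) =
    (if \<pi> e = 0 then 2 else \<bar>\<pi> e\<bar>)"
  by (simp add: replica_count_def)

text \<open>The two counts of an edge differ by its flow and are not both zero. If the flow is
  nonzero, the count in its direction is at least its absolute value, and the other bound is 0. If
  the flow is zero, the counts agree and so are both positive.\<close>

lemma replica_count_le_count_list:
  assumes "flow p = \<pi>" "e \<in> fst ` set p"
  shows "replica_count \<pi> (e, b) \<le> count_list p (e, b)"
proof -
  have f: "int (count_list p (e, True)) - int (count_list p (e, False)) = \<pi> e"
    using assms(1) by (auto simp: flow_def)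
  have "(e, True) \<in> set p \<or> (e, False) \<in> set p"
    using assms(2) by (auto, metis (full_types))
  then have "count_list p (e, True) \<noteq> 0 \<or> count_list p (e, False) \<noteq> 0"
    by (simp add: count_list_0_iff)
  then show ?thesis
    using f by (cases b) (auto simp: replica_count_def)
qed

lemma sum_times_bool: "(\<Sum>a\<in>E \<times> UNIV. f a) = (\<Sum>e\<in>E. f (e, True) + f (e, False))"
  by (simp add: sum.cartesian_product[symmetric, of "\<lambda>e b. f (e, b)", simplified] UNIV_bool add.commute)

context free_quotient
begin

section \<open>Replicas for a fixed word and a connecting subgraph\<close>

lemma wf_cayley_graph: "wf_digraph \<Gamma>"
  by unfold_locales (auto simp: cayley_graph_def intro!: G.m_closed coset_closed)

abbreviation "supp \<equiv> flow_support X N"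

context
  fixes w
  assumes w: "w \<in> carrier F"
begin

lemma w_words: "w \<in> words"
  using w by (simp add: carrier_F)

lemma word_flow_nonzero: "wflow w e \<noteq> 0 \<longleftrightarrow> e \<in> supp w"
proof -
  have "e \<in> arcs \<Gamma>" if "wflow w e \<noteq> 0"
    using that flow_eq_0[of e "path \<one>\<^bsub>G\<^esub> w"] path_edges[OF w_words G.one_closed]
    by (auto simp: word_flow_def word_path_def)
  then show ?thesis by (auto simp: flow_support_def)
qed

lemma finite_support: "finite (supp w)"
proof (rule finite_subset)
  show "supp w \<subseteq> fst ` set (path \<one>\<^bsub>G\<^esub> w)"
    unfolding subset_iff word_flow_nonzero[symmetric] word_flow_def word_path_def
    by (metis flow_eq_0)
qed simp

abbreviation "\<pi> \<equiv> wflow w"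
abbreviation "R \<equiv> replica_graph X N w"

context
  fixes Q
  assumes Q: "connecting_subgraph X N w Q"
begin

abbreviation "edges \<equiv> supp w \<union> arcs Q"

lemma fin_Q: "fin_digraph Q" and sub_Q: "subgraph Q \<Gamma>"
  using Q by (auto simp: connecting_subgraph_def)

lemma finite_edges: "finite edges"
  using finite_support fin_digraph.finite_arcs[OF fin_Q] by simp

text \<open>Both kinds of replicas form one family indexed by oriented edges; a direction against a
  nonzero flow contributes an empty range.\<close>

lemma arcs_replica_graph: "arcs (R Q) = (SIGMA a : edges \<times> UNIV. {..<replica_count \<pi> a})"
proof -
  have "arcs Q \<subseteq> arcs \<Gamma>" using sub_Q by (auto simp: subgraph_def)
  then show ?thesis
    by (auto simp: replica_graph_def replica_count_def word_flow_nonzero[symmetric] split: if_splits)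
qed

lemma card_arcs_replica_graph: "card (arcs (R Q)) = (\<Sum>a\<in>edges \<times> UNIV. replica_count \<pi> a)"
  unfolding arcs_replica_graph using finite_edges by (subst card_SigmaI) auto

text \<open>A connecting subgraph may overlap the support, hence the set difference. The factor 2
  stems from the two opposite replicas of an edge of zero flow.\<close>

lemma card_arcs_replica_graph_eq:
  "int (card (arcs (R Q))) = (\<Sum>e\<in>supp w. \<bar>\<pi> e\<bar>) + 2 * int (card (arcs Q - supp w))"
proof -
  have "int (card (arcs (R Q))) = (\<Sum>e\<in>edges. if \<pi> e = 0 then 2 else \<bar>\<pi> e\<bar>)"
    unfolding card_arcs_replica_graph sum_times_bool by (simp add: replica_count_add)
  also have "\<dots> = (\<Sum>e\<in>supp w \<union> (arcs Q - supp w). if \<pi> e = 0 then 2 else \<bar>\<pi> e\<bar>)"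
    by simp
  also have "\<dots> = (\<Sum>e\<in>supp w. if \<pi> e = 0 then 2 else \<bar>\<pi> e\<bar>) +
      (\<Sum>e\<in>arcs Q - supp w. if \<pi> e = 0 then 2 else \<bar>\<pi> e\<bar>)"
    using finite_support fin_digraph.finite_arcs[OF fin_Q] by (intro sum.union_disjoint) auto
  also have "(\<Sum>e\<in>supp w. if \<pi> e = 0 then 2 else \<bar>\<pi> e\<bar>) = (\<Sum>e\<in>supp w. \<bar>\<pi> e\<bar>)"
    by (intro sum.cong) (auto simp: word_flow_nonzero[symmetric])
  also have "(\<Sum>e\<in>arcs Q - supp w. if \<pi> e = 0 then 2 else \<bar>\<pi> e\<bar>) = (\<Sum>e\<in>arcs Q - supp w. 2)"
    by (intro sum.cong) (auto simp: word_flow_nonzero[symmetric])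
  finally show ?thesis by simp
qed

lemma tail_R: "tail (R Q) x = tail (with_inverses \<Gamma>) (fst x)"
  and head_R: "head (R Q) x = head (with_inverses \<Gamma>) (fst x)"
  by (simp_all add: replica_graph_def)

lemma cas_R: "pre_digraph.cas (R Q) g p h \<longleftrightarrow> pre_digraph.cas (with_inverses \<Gamma>) g (map fst p) h"
  by (induction p arbitrary: g) (auto simp: pre_digraph.cas.simps tail_R head_R)

lemma fin_digraph_R: "fin_digraph (R Q)"
proof -
  have compat: "tail Q = tail \<Gamma>" "head Q = head \<Gamma>" "wf_digraph Q"
    using sub_Q by (auto simp: subgraph_def compatible_def)
  have "e \<in> arcs Q \<Longrightarrow> tail \<Gamma> e \<in> verts Q" "e \<in> arcs Q \<Longrightarrow> head \<Gamma> e \<in> verts Q" for e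
    using wf_digraph.tail_in_verts[OF compat(3)] wf_digraph.head_in_verts[OF compat(3)] compat(1,2)
    by auto
  then interpret wf_digraph "R Q"
    by unfold_locales
      (auto 0 0 simp: replica_graph_def with_inverses_def Digraph_Component.union_def
        support_graph_def split: if_split_asm if_split)
  show ?thesis
  proof
    show "finite (verts (R Q))"
      using finite_support fin_digraph.finite_verts[OF fin_Q]
      by (simp add: replica_graph_def support_graph_def)
    show "finite (arcs (R Q))"
      unfolding arcs_replica_graph using finite_edges by auto
  qed
qed

text \<open>The replicas of \<open>e\<close> in its two directions differ in number by
  \<open>\<pi> e\<close>, so the difference of the degrees is the divergence of the flow of
  \<open>w\<close>.\<close>

lemma replica_graph_balance:
  "int (out_degree (R Q) v) - int (in_degree (R Q) v) =
    of_bool (\<one>\<^bsub>G\<^esub> = v) - of_bool (\<mu> w = v)"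
proof -
  let ?d = "\<lambda>e. of_bool (tail \<Gamma> e = v) - of_bool (head \<Gamma> e = v) :: int"
  let ?d' = "\<lambda>a. of_bool (tail (with_inverses \<Gamma>) a = v) - of_bool (head (with_inverses \<Gamma>) a = v) :: int"
  have fin: "finite (arcs (R Q))" by (rule fin_digraph.finite_arcs[OF fin_digraph_R])
  have "int (out_degree (R Q) v) = (\<Sum>x\<in>arcs (R Q). of_bool (tail (R Q) x = v))"
    "int (in_degree (R Q) v) = (\<Sum>x\<in>arcs (R Q). of_bool (head (R Q) x = v))"
    using fin by (simp_all add: out_degree_def out_arcs_def in_degree_def in_arcs_def Int_def)
  then have "int (out_degree (R Q) v) - int (in_degree (R Q) v) = (\<Sum>x\<in>arcs (R Q). ?d' (fst x))"
    by (simp add: tail_R head_R sum_subtractf)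
  \<comment> \<open>The summand ignores the index of a replica, so each oriented edge is weighted by
    its number of replicas.\<close>
  also have "\<dots> = (\<Sum>a\<in>edges \<times> UNIV. int (replica_count \<pi> a) * ?d' a)"
    unfolding arcs_replica_graph
    by (subst sum.Sigma[symmetric, where g = "\<lambda>a i. ?d' a", unfolded case_prod_beta])
      (use finite_edges in auto)
  also have "\<dots> = (\<Sum>e\<in>edges. \<pi> e * ?d e)"
    unfolding sum_times_bool
    by (intro sum.cong refl)
      (simp add: with_inverses_def algebra_simps flip: replica_count_diff[of \<pi>])
  \<comment> \<open>The index set is enlarged to contain the path of \<open>w\<close>, as
    \<open>flow_divergence\<close> requires; the new terms lie outside the support and
    vanish.\<close>
  also have "\<dots> = (\<Sum>e\<in>edges \<union> fst ` set (path \<one>\<^bsub>G\<^esub> w). \<pi> e * ?d e)"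
    using finite_edges by (intro sum.mono_neutral_left) (auto simp: word_flow_nonzero[symmetric])
  also have "\<dots> = of_bool (\<one>\<^bsub>G\<^esub> = v) - of_bool (\<one>\<^bsub>G\<^esub> \<otimes>\<^bsub>G\<^esub> \<mu> w = v)"
    using flow_divergence[OF conjunct1[OF path_cas[OF w_words G.one_closed]], of "edges \<union> fst ` set (path \<one>\<^bsub>G\<^esub> w)" v]
      finite_edges by (simp add: word_flow_def word_path_def)
  finally show ?thesis using coset_closed[OF w_words] by simp
qed

lemma euler_path_exists: "\<exists>p. euler_path X N w Q p"
proof -
  interpret fin_digraph "R Q" by (rule fin_digraph_R)
  have "Digraph_Component.connected (R Q)"
    using Q mk_symmetric_replica_graph[OF sub_Q]
    by (simp add: connecting_subgraph_def Digraph_Component.connected_def)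
  moreover have "\<one>\<^bsub>G\<^esub> \<in> verts (R Q)" "\<mu> w \<in> verts (R Q)"
    by (simp_all add: replica_graph_def support_graph_def)
  ultimately show ?thesis
    unfolding euler_path_def by (rule euler_trail_exists) (rule replica_graph_balance)
qed

text \<open>Forgetting the indices, an Euler path traverses each oriented edge as often as it has
  replicas, and the difference over the two directions is the flow of \<open>w\<close>.\<close>

lemma euler_word_props:
  assumes "euler_path X N w Q p"
  shows "euler_word p \<in> words" "wflow (euler_word p) = \<pi>" "length (euler_word p) = card (arcs (R Q))"
proof -
  have p: "pre_digraph.cas (R Q) \<one>\<^bsub>G\<^esub> p (\<mu> w)" "set p = arcs (R Q)" "distinct p"
    using assms unfolding euler_path_iff[OF Q] by (auto simp: pre_digraph.trail_def pre_digraph.awalk_def)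
  have sub: "set (map fst p) \<subseteq> arcs (with_inverses \<Gamma>)"
    using sub_Q unfolding set_map p(2) arcs_replica_graph
    by (auto simp: with_inverses_def subgraph_def flow_support_def)
  note label = path_of_label[OF p(1)[unfolded cas_R] sub G.one_closed]
  show "euler_word p \<in> words" using label by (simp add: euler_word_def)
  have "count_list (map fst p) a = (if fst a \<in> edges then replica_count \<pi> a else 0)" for a
    unfolding count_list_map_fst[OF p(3)] p(2) arcs_replica_graph by (cases a) (auto simp: lessThan_def[symmetric])
  then have "flow (map fst p) e = \<pi> e" for e
    using replica_count_diff[of \<pi> e] word_flow_nonzero[of e] by (auto simp: flow_def)
  then show "wflow (euler_word p) = \<pi>"
    using label by (auto simp: euler_word_def word_flow_def word_path_def)
  show "length (euler_word p) = card (arcs (R Q))"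
    using distinct_card[OF p(3)] p(2) by (simp add: euler_word_def path_label_def)
qed

end

end

section \<open>Geodesics and minimal forests\<close>

text \<open>The candidate for a forest that is read off from the path of \<open>v\<close>: what the
  path uses in addition to the support of its flow.\<close>

definition detour_graph :: "'a word \<Rightarrow> ('a vertex, 'a edge) pre_digraph" where
  "detour_graph v = (let E = {e \<in> fst ` set (path \<one>\<^bsub>G\<^esub> v). wflow v e = 0} in
    \<lparr>verts = tail \<Gamma> ` E \<union> head \<Gamma> ` E, arcs = E, tail = tail \<Gamma>, head = head \<Gamma>\<rparr>)"

section \<open>Words with the flow of \<open>w\<close> and their length\<close>

context
  fixes w
  assumes w: "w \<in> carrier F"
begin

context
  fixes v
  assumes v: "v \<in> carrier F" and flow_v: "wflow v = wflow w"
begin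

lemma v_words: "v \<in> words"
  using v by (simp add: carrier_F)

lemma support_detour_edges: "supp w \<union> arcs (detour_graph v) = fst ` set (path \<one>\<^bsub>G\<^esub> v)"
proof -
  have "e \<in> fst ` set (path \<one>\<^bsub>G\<^esub> v)" if "e \<in> supp w" for e
  proof -
    have "wflow v e \<noteq> 0" using that by (simp add: word_flow_nonzero[OF w] flow_v)
    then show ?thesis
      using flow_eq_0[of e "path \<one>\<^bsub>G\<^esub> v"] unfolding word_flow_def word_path_def by blast
  qed
  then show ?thesis
    using word_flow_nonzero[OF w] by (auto simp: detour_graph_def Let_def flow_v)
qed

lemma support_detour_disjoint: "arcs (detour_graph v) \<inter> supp w = {}"
  using word_flow_nonzero[OF w] by (auto simp: detour_graph_def Let_def flow_v)

text \<open>The path of \<open>v\<close> leads from the identity to \<open>\<mu> w\<close>, because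
  the flow determines the end point, and it runs through exactly the edges of the union. So every
  vertex is joined to the identity.\<close>

lemma connecting_detour_graph: "connecting_subgraph X N w (detour_graph v)"
proof -
  let ?E = "arcs (detour_graph v)"
  let ?U = "Digraph_Component.union (support_graph X N w) (detour_graph v)"
  have edges: "arcs ?U = fst ` set (path \<one>\<^bsub>G\<^esub> v)"
    using support_detour_edges by (simp add: support_graph_def)
  have sub: "?E \<subseteq> arcs \<Gamma>"
    using path_edges[OF v_words G.one_closed] support_detour_edges by blast
  have D: "verts (detour_graph v) = tail \<Gamma> ` ?E \<union> head \<Gamma> ` ?E"
    "tail (detour_graph v) = tail \<Gamma>" "head (detour_graph v) = head \<Gamma>"
    by (simp_all add: detour_graph_def Let_def)
  have fin: "finite ?E" by (simp add: detour_graph_def Let_def)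
  have fin_D: "fin_digraph (detour_graph v)"
    by unfold_locales (use fin in \<open>auto simp: D\<close>)
  have "subgraph (detour_graph v) \<Gamma>"
    unfolding subgraph_def compatible_def D
    using sub wf_cayley_graph fin_digraph.axioms(1)[OF fin_D]
      wf_digraph.tail_in_verts[OF wf_cayley_graph] wf_digraph.head_in_verts[OF wf_cayley_graph]
    by auto
  have U: "tail ?U = tail \<Gamma>" "head ?U = head \<Gamma>"
    "verts ?U = tail \<Gamma> ` arcs ?U \<union> head \<Gamma> ` arcs ?U \<union> {\<one>\<^bsub>G\<^esub>, \<mu> w}"
    by (auto simp: Digraph_Component.union_def support_graph_def D)
  interpret U: wf_digraph ?U
    by unfold_locales (unfold U, auto)
  interpret S: pair_wf_digraph "mk_symmetric ?U" by (rule U.wellformed_mk_symmetric)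
  \<comment> \<open>The union and the Cayley graph have the same end maps, so the path in one is a
    path in the other.\<close>
  have compat: "compatible (with_inverses ?U) (with_inverses \<Gamma>)"
    unfolding compatible_def with_inverses_def U(1,2) by simp
  have cas: "pre_digraph.cas (with_inverses ?U) \<one>\<^bsub>G\<^esub> (path \<one>\<^bsub>G\<^esub> v) (\<mu> w)"
    unfolding compatible_cas[OF compat]
    using path_cas[OF v_words G.one_closed] coset_closed[OF v_words]
      coset_eq_if_word_flow_eq(1)[OF v w flow_v] by simp
  have one: "\<one>\<^bsub>G\<^esub> \<in> verts ?U" unfolding U by blast
  note reach = U.reachable_with_inverses[OF cas equalityD2[OF edges] one]
  have "\<one>\<^bsub>G\<^esub> \<rightarrow>\<^sup>*\<^bsub>mk_symmetric ?U\<^esub> \<one>\<^bsub>G\<^esub>"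
    using one by (intro S.reachable_refl) simp
  then have from_one: "\<one>\<^bsub>G\<^esub> \<rightarrow>\<^sup>*\<^bsub>mk_symmetric ?U\<^esub> x" if "x \<in> verts ?U" for x
    using reach that unfolding U edges by auto
  have "x \<rightarrow>\<^sup>*\<^bsub>mk_symmetric ?U\<^esub> y" if "x \<in> verts ?U" "y \<in> verts ?U" for x y
    by (rule S.reachable_trans[OF _ from_one[OF that(2)]])
      (rule symmetric_reachable[OF symmetric_mk_symmetric from_one[OF that(1)]])
  then have "Digraph_Component.connected ?U"
    using one by (intro U.connectedI) blast+
  then show ?thesis
    using fin_D \<open>subgraph (detour_graph v) \<Gamma>\<close> by (simp add: connecting_subgraph_def)
qed

lemma length_eq_sum_count_list:
  "length v = (\<Sum>a\<in>(supp w \<union> arcs (detour_graph v)) \<times> UNIV. count_list (path \<one>\<^bsub>G\<^esub> v) a)"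
proof -
  have "length v = length (path \<one>\<^bsub>G\<^esub> v)"
    using arg_cong[OF path_label_word_path, of length X N v] by (simp add: word_path_def path_label_def)
  then show ?thesis
    unfolding support_detour_edges by (subst sum_count_set) force+
qed

lemma replica_count_le: 
  assumes "a \<in> (supp w \<union> arcs (detour_graph v)) \<times> UNIV"
  shows "replica_count (wflow w) a \<le> count_list (path \<one>\<^bsub>G\<^esub> v) a"
proof -
  have "flow (path \<one>\<^bsub>G\<^esub> v) = wflow w"
    using flow_v by (simp add: word_flow_def word_path_def)
  moreover have "fst a \<in> fst ` set (path \<one>\<^bsub>G\<^esub> v)"
    using assms unfolding support_detour_edges by (metis mem_Times_iff)
  ultimately show ?thesis
    using replica_count_le_count_list[of _ "wflow w" "fst a" "snd a"] by simp
qed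

lemma card_replica_le_length: "card (arcs (replica_graph X N w (detour_graph v))) \<le> length v"
  unfolding card_arcs_replica_graph[OF w connecting_detour_graph] length_eq_sum_count_list
  by (rule sum_mono) (rule replica_count_le)

text \<open>Equality of the sums in \<open>card_replica_le_length\<close> forces equality for every
  oriented edge, so distributing the traversals over the replicas exhausts them.\<close>

lemma euler_path_lift:
  assumes "length v = card (arcs (replica_graph X N w (detour_graph v)))"
  shows "\<exists>p. euler_path X N w (detour_graph v) p \<and> euler_word p = v"
proof -
  let ?R = "replica_graph X N w (detour_graph v)" and ?p = "path \<one>\<^bsub>G\<^esub> v"
  let ?E = "supp w \<union> arcs (detour_graph v)"
  have eq: "count_list ?p a = replica_count (wflow w) a" if "a \<in> ?E \<times> UNIV" for a
  proof (rule ccontr)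
    assume "count_list ?p a \<noteq> replica_count (wflow w) a"
    then have less: "replica_count (wflow w) a < count_list ?p a"
      using replica_count_le[OF that] by simp
    have "(\<Sum>a\<in>?E \<times> UNIV. replica_count (wflow w) a) < (\<Sum>a\<in>?E \<times> UNIV. count_list ?p a)"
    proof (rule sum_strict_mono_ex1)
      show "finite (?E \<times> (UNIV :: bool set))"
        using finite_edges[OF w connecting_detour_graph] by (intro finite_cartesian_product) simp_all
    qed (use less that replica_count_le in blast)+
    then show False
      using assms unfolding card_arcs_replica_graph[OF w connecting_detour_graph] length_eq_sum_count_list
      by simp
  qed
  \<comment> \<open>Successive traversals of an oriented edge take its replicas with index 0, 1, and
    so on.\<close>
  obtain p where p: "map fst p = ?p" "distinct p" "set p = {(a, i). i < count_list ?p a}"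
    using lift_distinct by metis
  have "count_list ?p a = 0" if "a \<notin> ?E \<times> UNIV" for a
    using that unfolding support_detour_edges count_list_0_iff by (cases a) force
  then have "i < count_list ?p a \<longleftrightarrow> a \<in> ?E \<times> UNIV \<and> i < replica_count (wflow w) a" for a i
    using eq by (metis not_less_zero)
  moreover have "Sigma B (\<lambda>a. {..<c a}) = {(a, i). a \<in> B \<and> i < c a}" for B :: "('a edge \<times> bool) set" and c :: "_ \<Rightarrow> nat"
    by auto
  ultimately have "set p = (SIGMA a : ?E \<times> UNIV. {..<replica_count (wflow w) a})"
    unfolding p(3) by presburger
  then have set: "set p = arcs ?R"
    by (simp only: arcs_replica_graph[OF w connecting_detour_graph])
  have "pre_digraph.cas ?R \<one>\<^bsub>G\<^esub> p (\<mu> w)"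
    unfolding cas_R[OF w connecting_detour_graph] p(1)
    using path_cas[OF v_words G.one_closed] coset_closed[OF v_words]
      coset_eq_if_word_flow_eq(1)[OF v w flow_v] by simp
  moreover have "\<one>\<^bsub>G\<^esub> \<in> verts ?R"
    by (simp add: replica_graph_def support_graph_def)
  ultimately have "euler_path X N w (detour_graph v) p"
    unfolding euler_path_iff[OF connecting_detour_graph] pre_digraph.trail_def pre_digraph.awalk_def
    using p(2) set by simp
  moreover have "euler_word p = v"
    using path_label_word_path[of X N v] by (simp add: euler_word_def p(1) word_path_def)
  ultimately show ?thesis by blast
qed

end

text \<open>Deleting the support edges from \<open>Q\<close> but keeping its vertices leaves the
  union with the support graph unchanged, so by minimality there is nothing to delete.\<close>

lemma minimal_forest_disjoint:
  assumes "minimal_forest X N w Q"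
  shows "arcs Q \<inter> supp w = {}"
proof -
  define Q' where "Q' = Q\<lparr>arcs := arcs Q - supp w\<rparr>"
  have Q: "connecting_subgraph X N w Q" using assms by (simp add: minimal_forest_def)
  note fin = fin_Q[OF w Q]
  have sub: "subgraph Q \<Gamma>" using Q by (simp add: connecting_subgraph_def)
  interpret Q: fin_digraph Q by (rule fin)
  have fin': "fin_digraph Q'"
    by unfold_locales (auto simp: Q'_def)
  have "subgraph Q' \<Gamma>"
    using sub fin_digraph.axioms(1)[OF fin'] by (auto simp: subgraph_def compatible_def Q'_def)
  moreover have "Digraph_Component.union (support_graph X N w) Q' = Digraph_Component.union (support_graph X N w) Q"
    by (auto simp: Digraph_Component.union_def support_graph_def Q'_def)
  ultimately have "connecting_subgraph X N w Q'"
    using Q fin' by (simp add: connecting_subgraph_def)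
  then have "card (arcs Q) \<le> card (arcs Q - supp w)"
    using assms by (auto simp: minimal_forest_def Q'_def)
  then show ?thesis
    using psubset_card_mono[OF Q.finite_arcs, of "arcs Q - supp w"] by fastforce
qed

text \<open>The support contributes equally to both sides, and the rest is twice the number of edges
  of the forest.\<close>

lemma minimal_forest_cost_le:
  assumes "minimal_forest X N w Q" "v \<in> carrier F" "wflow v = wflow w"
  shows "card (arcs (replica_graph X N w Q)) \<le> card (arcs (replica_graph X N w (detour_graph v)))"
proof -
  have Q: "connecting_subgraph X N w Q" using assms by (simp add: minimal_forest_def)
  note Q' = connecting_detour_graph[OF assms(2,3)]
  have "arcs Q - supp w = arcs Q" "arcs (detour_graph v) - supp w = arcs (detour_graph v)"
    using minimal_forest_disjoint[OF assms(1)] support_detour_disjoint[OF assms(2,3)] by auto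
  moreover have "card (arcs Q) \<le> card (arcs (detour_graph v))"
    using assms(1) Q' by (simp add: minimal_forest_def)
  ultimately show ?thesis
    using card_arcs_replica_graph_eq[OF w Q] card_arcs_replica_graph_eq[OF w Q'] by simp
qed

lemma minimal_forest_le_length:
  assumes "minimal_forest X N w Q" "v \<in> carrier F" "D #>\<^bsub>F\<^esub> v = D #>\<^bsub>F\<^esub> w"
  shows "card (arcs (replica_graph X N w Q)) \<le> length v"
  using word_flow_eq_if_coset_eq[OF assms(2) w assms(3)]
    minimal_forest_cost_le[OF assms(1,2)] card_replica_le_length[OF assms(2)] by fastforce

lemma euler_word_geodesic:
  assumes "minimal_forest X N w Q" "euler_path X N w Q p"
  shows "geodesic_length X D w = card (arcs (replica_graph X N w Q))"
    and "geodesic_word X D w (euler_word p)"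
proof -
  have Q: "connecting_subgraph X N w Q" using assms by (simp add: minimal_forest_def)
  note u = euler_word_props[OF w Q assms(2)]
  let ?u = "free_reduce (euler_word p)" and ?n = "card (arcs (replica_graph X N w Q))"
  have u': "?u \<in> carrier F" by (rule free_reduce_closed[OF u(1)])
  have c: "D #>\<^bsub>F\<^esub> ?u = D #>\<^bsub>F\<^esub> w"
    by (rule coset_eq_if_word_flow_eq(2)[OF u' w]) (simp add: word_flow_free_reduce[OF u(1)] u(2))
  \<comment> \<open>The lower bound applies to the reduced word, yet it equals the length of the
    unreduced label. Hence nothing cancels and the label is itself reduced.\<close>
  have "?n \<le> length ?u" by (rule minimal_forest_le_length[OF assms(1) u' c])
  then have len: "length ?u = ?n" and red: "?u = euler_word p"
    using length_free_reduce[of "euler_word p"] free_reduce_length_eq[of "euler_word p"] u(3) by auto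
  show l: "geodesic_length X D w = ?n"
    unfolding geodesic_length_def
  proof (rule Least_equality)
    show "\<exists>u\<in>carrier F. D #>\<^bsub>F\<^esub> u = D #>\<^bsub>F\<^esub> w \<and> length u = ?n" using u' c len by blast
  qed (use minimal_forest_le_length[OF assms(1)] in blast)
  show "geodesic_word X D w (euler_word p)"
    unfolding geodesic_word_def using u' c len l by (simp add: red)
qed

text \<open>The path of \<open>w\<close> itself supplies a connecting subgraph, and edge numbers are
  natural numbers.\<close>

lemma minimal_forest_exists: "\<exists>Q. minimal_forest X N w Q"
  using connecting_detour_graph[OF w refl]
    ex_has_least_nat[of "connecting_subgraph X N w" _ "\<lambda>Q. card (arcs Q)"]
  unfolding minimal_forest_def by blast

lemma geodesic_word_is_euler_word:
  assumes "geodesic_word X D w u"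
  shows "\<exists>Q p. minimal_forest X N w Q \<and> euler_path X N w Q p \<and> euler_word p = u"
proof -
  have u: "u \<in> carrier F" "D #>\<^bsub>F\<^esub> u = D #>\<^bsub>F\<^esub> w" "length u = geodesic_length X D w"
    using assms by (simp_all add: geodesic_word_def)
  note flow = word_flow_eq_if_coset_eq[OF u(1) w u(2)]
  note Qu = connecting_detour_graph[OF u(1) flow]
  obtain Q where Q: "minimal_forest X N w Q" using minimal_forest_exists by blast
  then have cQ: "connecting_subgraph X N w Q" by (simp add: minimal_forest_def)
  \<comment> \<open>This Euler path for an arbitrary minimal forest serves to evaluate the geodesic
    length.\<close>
  obtain p where "euler_path X N w Q p" using euler_path_exists[OF w cQ] by blast
  then have len: "length u = card (arcs (replica_graph X N w Q))"
    using euler_word_geodesic(1)[OF Q] u(3) by simp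
  \<comment> \<open>The replicas of \<open>Q\<close> are at most as many as those of
    \<open>detour_graph u\<close>, which are at most \<open>length u\<close>; the two extremes
    agree. So \<open>detour_graph u\<close> is minimal as well and the path of \<open>u\<close>
    lifts to it.\<close>
  have eq: "length u = card (arcs (replica_graph X N w (detour_graph u)))"
    using len minimal_forest_cost_le[OF Q u(1) flow] card_replica_le_length[OF u(1) flow] by simp
  have "arcs Q - supp w = arcs Q" "arcs (detour_graph u) - supp w = arcs (detour_graph u)"
    using minimal_forest_disjoint[OF Q] support_detour_disjoint[OF u(1) flow] by auto
  then have "card (arcs (detour_graph u)) = card (arcs Q)"
    using card_arcs_replica_graph_eq[OF w cQ] card_arcs_replica_graph_eq[OF w Qu] len eq by simp
  then have "minimal_forest X N w (detour_graph u)"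
    using Q Qu by (simp add: minimal_forest_def)
  then show ?thesis using euler_path_lift[OF u(1) flow eq] by blast
qed

end

end

theorem theorem2p10:
  fixes X :: "'a set" and N :: "'a word set" and w :: "'a word"
  assumes "finite X"
    and "N \<lhd> free_group X"
    and "w \<in> carrier (free_group X)"
  shows
    "(\<forall>Q. minimal_forest X N w Q \<longrightarrow>
        (\<exists>p. euler_path X N w Q p) \<and>
        (\<forall>p. euler_path X N w Q p \<longrightarrow>
           geodesic_word X (derived (free_group X) N) w (euler_word p)) \<and>
        int (geodesic_length X (derived (free_group X) N) w) =
          (\<Sum>e\<in>flow_support X N w. \<bar>word_flow X N w e\<bar>) + 2 * int (card (arcs Q))) \<and>
     (\<forall>u. geodesic_word X (derived (free_group X) N) w u \<longrightarrow>
        (\<exists>Q p. minimal_forest X N w Q \<and> euler_path X N w Q p \<and>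
           free_reduce (euler_word p) = u))"
proof -
  interpret free_quotient X N by (rule free_quotient.intro) (rule assms(2))
  note w = assms(3)
  show ?thesis
  proof (intro conjI allI impI)
    fix Q assume Q: "minimal_forest X N w Q"
    then have cQ: "connecting_subgraph X N w Q" by (simp add: minimal_forest_def)
    show ex: "\<exists>p. euler_path X N w Q p" by (rule euler_path_exists[OF w cQ])
    show "geodesic_word X D w (euler_word p)" if "euler_path X N w Q p" for p
      by (rule euler_word_geodesic(2)[OF w Q that])
    have "arcs Q - supp w = arcs Q" using minimal_forest_disjoint[OF w Q] by blast
    then show "int (geodesic_length X D w) = (\<Sum>e\<in>supp w. \<bar>wflow w e\<bar>) + 2 * int (card (arcs Q))"
      using ex euler_word_geodesic(1)[OF w Q] card_arcs_replica_graph_eq[OF w cQ] by auto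
  next
    fix u assume u: "geodesic_word X D w u"
    \<comment> \<open>A geodesic word is reduced, so it is literally the label of an Euler path and
      the reduction in the claim leaves it unchanged.\<close>
    then have "free_reduce u = u" by (simp add: geodesic_word_def carrier_F free_reduce_id)
    then show "\<exists>Q p. minimal_forest X N w Q \<and> euler_path X N w Q p \<and> free_reduce (euler_word p) = u"
      using geodesic_word_is_euler_word[OF w u] by metis
  qed
qed

end
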